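(* Let $\alpha>0$, $\beta,h,\mu\in\mathbb{R}$, and let $c=0$. Let $\mathcal W$ be the set of wavetrain parameters, i.e. the set of $(k,\theta)$, with $\theta$ an angle modulo $2\pi$ and $k\in\mathbb{R}$, $k^2\neq\mu$, solving $$\cos\theta=\frac{h-\beta/\alpha}{\mu-k^2}.$$ There are three types of wavetrain parameter sets: 1. For supercritical anisotropy there is one connected component of wavetrain parameters including $k=0$, and two connected components with unbounded $|k|$, each with constant sign of $k$. 2. For subcritical anisotropy there are two connected components with unbounded $|k|$, each with constant sign of $k$. 3. For subsubcritical anisotropy there are two connected components, each a graph over the $k$-axis. The Hopf-type instability of $\pm\boldsymbol{\hat e}_3$ at the transition from sub- to supercritical anisotropy is a supercritical bifurcation in the sense that solutions emerge at the loss of stability of the basic solution, here $\pm\boldsymbol{\hat e}_3$, while that at the transition from sub- to subsubcritical anisotropy is subcritical in the sense that solutions emerge at the gain of stability.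
   Context: Consider the equation for $\boldsymbol m(x,t)\in\mathbb{S}^2$, $x\in\mathbb{R}$, in the case $c=0$ of vanishing polarization parameter: $$\partial_t\boldsymbol m=\boldsymbol m\times\big[\alpha\partial_t\boldsymbol m-\partial_x^2\boldsymbol m+(\mu m_3-h)\boldsymbol{\hat e}_3+\beta\,\boldsymbol m\times\boldsymbol{\hat e}_3\big].$$ Write $\boldsymbol m=(e^{i\varphi}\sin\theta,\cos\theta)$, identifying the $(m_1,m_2)$-plane with $\mathbb{C}$. Wavetrains are solutions with $\varphi=kx-\omega t$ and $\theta$ constant; $k$ is the wavenumber and $\omega$ the frequency. For $c=0$ and $\sin\theta\neq0$ the wavetrain conditions are $\omega=-\beta/\alpha$ and $\cos\theta=(h-\beta/\alpha)/(\mu-k^2)$ (for $\mu\neq k^2$). The anisotropy $\mu$ is called supercritical if $\boldsymbol{\hat e}_3$ and $-\boldsymbol{\hat e}_3$ are both unstable, subcritical if they have different stability, and subsubcritical if both are stable. For $c=0$, $\boldsymbol{\hat e}_3$ is strictly stable iff $\mu<h-\beta/\alpha$ and $-\boldsymbol{\hat e}_3$ iff $\mu<-(h-\beta/\alpha)$; thus supercritical means $\mu>|h-\beta/\alpha|$ and subsubcritical means $-\mu>|h-\beta/\alpha|$. The instabilities of $\pm\boldsymbol{\hat e}_3$ are of Hopf type for the essential spectrum, with critical Fourier wavenumber $0$.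
   Formalization: Item 1 is stated for h ≠ β/α, since for h = β/α and μ > 0 the equation is cos θ = 0 and there are six components; Hopf type is asserted only for β ≠ 0, since the critical eigenvalues ±iβ/α vanish when β = 0 (the bifurcation claims are kept for all β). *)

theory Defs
  imports "HOL-Analysis.Analysis"
begin

section \<open>The LLGS equation with vanishing polarization parameter\<close>

abbreviation e3 :: "real^3" where
  "e3 \<equiv> axis 3 1"

text \<open>The right-hand side as a function of the values \<open>m\<close>, \<open>p\<close>, \<open>q\<close> of \<open>\<^bold>m\<close>, its time derivative
  and its second space derivative.\<close>

definition llgs_rhs ::
    "real \<Rightarrow> real \<Rightarrow> real \<Rightarrow> real \<Rightarrow> real^3 \<Rightarrow> real^3 \<Rightarrow> real^3 \<Rightarrow> real^3" where
  "llgs_rhs \<alpha> \<beta> h \<mu> m p q =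
     cross3 m (\<alpha> *\<^sub>R p - q + (\<mu> * m $ 3 - h) *\<^sub>R e3 + \<beta> *\<^sub>R cross3 m e3)"

text \<open>Fields are functions \<open>u x t\<close> of space and time; \<open>ut\<close> and \<open>uxx\<close> are the classical partial
  derivatives of first order in time and second order in space.\<close>

definition has_partials ::
    "(real \<Rightarrow> real \<Rightarrow> real^3) \<Rightarrow> (real \<Rightarrow> real \<Rightarrow> real^3) \<Rightarrow> (real \<Rightarrow> real \<Rightarrow> real^3) \<Rightarrow> bool" where
  "has_partials u ut uxx \<longleftrightarrow>
     (\<forall>x t. ((\<lambda>s. u x s) has_vector_derivative ut x t) (at t)) \<and>
     (\<exists>ux. \<forall>x t. ((\<lambda>y. u y t) has_vector_derivative ux x t) (at x) \<and>
                 ((\<lambda>y. ux y t) has_vector_derivative uxx x t) (at x))"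

definition llgs_solution ::
    "real \<Rightarrow> real \<Rightarrow> real \<Rightarrow> real \<Rightarrow> (real \<Rightarrow> real \<Rightarrow> real^3) \<Rightarrow> bool" where
  "llgs_solution \<alpha> \<beta> h \<mu> m \<longleftrightarrow>
     (\<forall>x t. norm (m x t) = 1) \<and>
     (\<exists>mt mxx. has_partials m mt mxx \<and>
        (\<forall>x t. mt x t = llgs_rhs \<alpha> \<beta> h \<mu> (m x t) (mt x t) (mxx x t)))"

definition wavetrain :: "real \<Rightarrow> real \<Rightarrow> real \<Rightarrow> real \<Rightarrow> real \<Rightarrow> real^3" where
  "wavetrain k \<omega> \<theta> x t =
     vector [cos (k * x - \<omega> * t) * sin \<theta>, sin (k * x - \<omega> * t) * sin \<theta>, cos \<theta>]"


section \<open>Stability of the constant states\<close>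

text \<open>Linearization at a constant equilibrium \<open>b\<close>: the equation for tangential perturbations \<open>v\<close>
  obtained by differentiating the equation for \<open>b + s v\<close> with respect to \<open>s\<close> at \<open>s = 0\<close>.\<close>

definition linearized_solution ::
    "real \<Rightarrow> real \<Rightarrow> real \<Rightarrow> real \<Rightarrow> real^3 \<Rightarrow> (real \<Rightarrow> real \<Rightarrow> real^3) \<Rightarrow> bool" where
  "linearized_solution \<alpha> \<beta> h \<mu> b v \<longleftrightarrow>
     (\<forall>x t. inner b (v x t) = 0) \<and>
     (\<exists>vt vxx. has_partials v vt vxx \<and>
        (\<forall>x t. ((\<lambda>s. llgs_rhs \<alpha> \<beta> h \<mu> (b + s *\<^sub>R v x t) (s *\<^sub>R vt x t) (s *\<^sub>R vxx x t))
                  has_vector_derivative vt x t) (at 0)))"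

text \<open>A complex field solves the (real) linearized equation iff its real and imaginary parts do.
  Asking this of the real part only would be wrong: it can vanish identically.\<close>

definition fourier_mode ::
    "real \<Rightarrow> real \<Rightarrow> real \<Rightarrow> real \<Rightarrow> real^3 \<Rightarrow> real \<Rightarrow> complex \<Rightarrow> bool" where
  "fourier_mode \<alpha> \<beta> h \<mu> b \<xi> \<nu> \<longleftrightarrow>
     (\<exists>V :: complex^3. V \<noteq> 0 \<and>
        linearized_solution \<alpha> \<beta> h \<mu> b
          (\<lambda>x t. \<chi> j. Re (exp (\<nu> * of_real t + \<i> * of_real (\<xi> * x)) * V $ j)) \<and>
        linearized_solution \<alpha> \<beta> h \<mu> b
          (\<lambda>x t. \<chi> j. Im (exp (\<nu> * of_real t + \<i> * of_real (\<xi> * x)) * V $ j)))"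

text \<open>The coefficients being constant, the spectrum is essential and consists of the growth rates
  of the Fourier modes with real wavenumber.\<close>

definition spectrum ::
    "real \<Rightarrow> real \<Rightarrow> real \<Rightarrow> real \<Rightarrow> real^3 \<Rightarrow> complex set" where
  "spectrum \<alpha> \<beta> h \<mu> b = {\<nu>. \<exists>\<xi>. fourier_mode \<alpha> \<beta> h \<mu> b \<xi> \<nu>}"

definition strictly_stable :: "real \<Rightarrow> real \<Rightarrow> real \<Rightarrow> real \<Rightarrow> real^3 \<Rightarrow> bool" where
  "strictly_stable \<alpha> \<beta> h \<mu> b \<longleftrightarrow> (\<exists>\<delta>>0. \<forall>\<nu>\<in>spectrum \<alpha> \<beta> h \<mu> b. Re \<nu> \<le> - \<delta>)"

definition unstable :: "real \<Rightarrow> real \<Rightarrow> real \<Rightarrow> real \<Rightarrow> real^3 \<Rightarrow> bool" where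
  "unstable \<alpha> \<beta> h \<mu> b \<longleftrightarrow> (\<exists>\<nu>\<in>spectrum \<alpha> \<beta> h \<mu> b. Re \<nu> > 0)"

text \<open>At the threshold the spectrum touches the imaginary axis from the left exactly in a
  nonzero complex conjugate pair, attained at wavenumber \<open>0\<close> only.\<close>

definition hopf_threshold :: "real \<Rightarrow> real \<Rightarrow> real \<Rightarrow> real \<Rightarrow> real^3 \<Rightarrow> bool" where
  "hopf_threshold \<alpha> \<beta> h \<mu> b \<longleftrightarrow>
     (\<forall>\<nu>\<in>spectrum \<alpha> \<beta> h \<mu> b. Re \<nu> \<le> 0) \<and>
     (\<exists>\<omega>>0. {(\<xi>, \<nu>). fourier_mode \<alpha> \<beta> h \<mu> b \<xi> \<nu> \<and> Re \<nu> = 0} =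
        {(0, Complex 0 \<omega>), (0, Complex 0 (- \<omega>))})"


section \<open>Anisotropy regimes\<close>

text \<open>The marginal values of \<open>\<mu>\<close>, where one of the two states is neither strictly stable nor
  unstable, belong to none of the regimes.\<close>

definition supercritical :: "real \<Rightarrow> real \<Rightarrow> real \<Rightarrow> real \<Rightarrow> bool" where
  "supercritical \<alpha> \<beta> h \<mu> \<longleftrightarrow> unstable \<alpha> \<beta> h \<mu> e3 \<and> unstable \<alpha> \<beta> h \<mu> (- e3)"

definition subcritical :: "real \<Rightarrow> real \<Rightarrow> real \<Rightarrow> real \<Rightarrow> bool" where
  "subcritical \<alpha> \<beta> h \<mu> \<longleftrightarrow>
     strictly_stable \<alpha> \<beta> h \<mu> e3 \<and> unstable \<alpha> \<beta> h \<mu> (- e3) \<or>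
     unstable \<alpha> \<beta> h \<mu> e3 \<and> strictly_stable \<alpha> \<beta> h \<mu> (- e3)"

definition subsubcritical :: "real \<Rightarrow> real \<Rightarrow> real \<Rightarrow> real \<Rightarrow> bool" where
  "subsubcritical \<alpha> \<beta> h \<mu> \<longleftrightarrow>
     strictly_stable \<alpha> \<beta> h \<mu> e3 \<and> strictly_stable \<alpha> \<beta> h \<mu> (- e3)"


section \<open>Wavetrain parameters\<close>

text \<open>An angle modulo \<open>2 \<pi>\<close> is represented by the point \<open>cis \<theta>\<close> of the unit circle, so that
  connected components are taken in \<open>\<real> \<times> S\<^sup>1\<close>.\<close>

definition wavetrain_parameters ::
    "real \<Rightarrow> real \<Rightarrow> real \<Rightarrow> real \<Rightarrow> (real \<times> complex) set" where
  "wavetrain_parameters \<alpha> \<beta> h \<mu> =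
     {(k, cis \<theta>) |k \<theta>. k\<^sup>2 \<noteq> \<mu> \<and> cos \<theta> = (h - \<beta> / \<alpha>) / (\<mu> - k\<^sup>2)}"

definition graph_over_k_axis :: "(real \<times> complex) set \<Rightarrow> bool" where
  "graph_over_k_axis C \<longleftrightarrow>
     (\<exists>\<theta> :: real \<Rightarrow> real. continuous_on UNIV \<theta> \<and> C = range (\<lambda>k. (k, cis (\<theta> k))))"


section \<open>Transitions and bifurcations as the anisotropy varies\<close>

text \<open>Moving \<open>\<mu>\<close> through \<open>\<mu>\<^sub>c\<close>, increasingly or decreasingly, leads from \<open>P\<close> to \<open>Q\<close>. The filter
  \<open>F\<close> is the side of \<open>\<mu>\<^sub>c\<close> before and \<open>G\<close> the side after the transition.\<close>

definition transition ::
    "(real \<Rightarrow> bool) \<Rightarrow> (real \<Rightarrow> bool) \<Rightarrow> real \<Rightarrow> real filter \<Rightarrow> real filter \<Rightarrow> bool" where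
  "transition P Q \<mu>\<^sub>c F G \<longleftrightarrow>
     (F = at_left \<mu>\<^sub>c \<and> G = at_right \<mu>\<^sub>c \<or> F = at_right \<mu>\<^sub>c \<and> G = at_left \<mu>\<^sub>c) \<and>
     eventually P F \<and> eventually Q G"

definition loses_stability ::
    "real \<Rightarrow> real \<Rightarrow> real \<Rightarrow> real^3 \<Rightarrow> real \<Rightarrow> real filter \<Rightarrow> real filter \<Rightarrow> bool" where
  "loses_stability \<alpha> \<beta> h b \<mu>\<^sub>c F G \<longleftrightarrow>
     transition (\<lambda>\<mu>. strictly_stable \<alpha> \<beta> h \<mu> b) (\<lambda>\<mu>. unstable \<alpha> \<beta> h \<mu> b) \<mu>\<^sub>c F G"

definition gains_stability ::
    "real \<Rightarrow> real \<Rightarrow> real \<Rightarrow> real^3 \<Rightarrow> real \<Rightarrow> real filter \<Rightarrow> real filter \<Rightarrow> bool" where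
  "gains_stability \<alpha> \<beta> h b \<mu>\<^sub>c F G \<longleftrightarrow>
     transition (\<lambda>\<mu>. unstable \<alpha> \<beta> h \<mu> b) (\<lambda>\<mu>. strictly_stable \<alpha> \<beta> h \<mu> b) \<mu>\<^sub>c F G"

text \<open>Emergence of solutions from the basic state \<open>b\<close>: wavetrains with \<open>sin \<theta> \<noteq> 0\<close> and the
  critical wavenumber \<open>0\<close> exist after the transition and shrink to \<open>b\<close> at \<open>\<mu>\<^sub>c\<close>, while there
  are none at \<open>\<mu>\<^sub>c\<close> and before.\<close>

definition solutions_emerge ::
    "real \<Rightarrow> real \<Rightarrow> real \<Rightarrow> real^3 \<Rightarrow> real \<Rightarrow> real filter \<Rightarrow> real filter \<Rightarrow> bool" where
  "solutions_emerge \<alpha> \<beta> h b \<mu>\<^sub>c F G \<longleftrightarrow>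
     (\<exists>\<omega> \<theta>. (\<forall>\<^sub>F \<mu> in G. sin (\<theta> \<mu>) \<noteq> 0 \<and>
                llgs_solution \<alpha> \<beta> h \<mu> (wavetrain 0 (\<omega> \<mu>) (\<theta> \<mu>))) \<and>
             uniform_limit UNIV (\<lambda>\<mu> (x, t). wavetrain 0 (\<omega> \<mu>) (\<theta> \<mu>) x t) (\<lambda>_. b) G) \<and>
     (\<forall>\<omega> \<theta>. sin \<theta> \<noteq> 0 \<longrightarrow> \<not> llgs_solution \<alpha> \<beta> h \<mu>\<^sub>c (wavetrain 0 \<omega> \<theta>)) \<and>
     (\<forall>\<^sub>F \<mu> in F. \<forall>\<omega> \<theta>. sin \<theta> \<noteq> 0 \<longrightarrow> \<not> llgs_solution \<alpha> \<beta> h \<mu> (wavetrain 0 \<omega> \<theta>))"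

definition supercritical_bifurcation ::
    "real \<Rightarrow> real \<Rightarrow> real \<Rightarrow> real^3 \<Rightarrow> real \<Rightarrow> real filter \<Rightarrow> real filter \<Rightarrow> bool" where
  "supercritical_bifurcation \<alpha> \<beta> h b \<mu>\<^sub>c F G \<longleftrightarrow>
     loses_stability \<alpha> \<beta> h b \<mu>\<^sub>c F G \<and> solutions_emerge \<alpha> \<beta> h b \<mu>\<^sub>c F G"

definition subcritical_bifurcation ::
    "real \<Rightarrow> real \<Rightarrow> real \<Rightarrow> real^3 \<Rightarrow> real \<Rightarrow> real filter \<Rightarrow> real filter \<Rightarrow> bool" where
  "subcritical_bifurcation \<alpha> \<beta> h b \<mu>\<^sub>c F G \<longleftrightarrow>
     gains_stability \<alpha> \<beta> h b \<mu>\<^sub>c F G \<and> solutions_emerge \<alpha> \<beta> h b \<mu>\<^sub>c F G"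

end

theory Submission
  imports Defs
begin

text \<open>
  Put \<open>D = h - \<beta> / \<alpha>\<close>. The whole picture is governed by comparing \<open>\<mu>\<close> with \<open>\<plusminus>D\<close>.

  \<^emph>\<open>Stability.\<close> Let \<open>\<epsilon> = \<plusminus>1\<close>. In the complex coordinate \<open>v = v\<^sub>1 + \<i> v\<^sub>2\<close> of the tangent
  plane at \<open>\<epsilon> e\<^sub>3\<close> the linearized equation is the scalar equation
  \<open>(\<alpha> + \<i> \<epsilon>) v\<^sub>t = v\<^sub>x\<^sub>x + (\<mu> - \<epsilon> h + \<i> \<beta>) v\<close>. Hence a mode with wavenumber \<open>\<xi>\<close> grows with one of two
  complex conjugate rates, whose common real part is a positive multiple of \<open>\<mu> - \<epsilon> D - \<xi>\<^sup>2\<close>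
  (\<open>fourier_mode_iff\<close>, \<open>Re_growth_rate\<close>). The mode \<open>\<xi> = 0\<close> is the most unstable one, so the pole
  \<open>\<epsilon> e\<^sub>3\<close> is strictly stable for \<open>\<mu> < \<epsilon> D\<close> and unstable for \<open>\<mu> > \<epsilon> D\<close>; at \<open>\<mu> = \<epsilon> D\<close> the critical
  rates are \<open>\<plusminus>\<i> \<beta> / \<alpha>\<close>. The three regimes become \<open>\<mu> > \<bar>D\<bar>\<close>, \<open>\<bar>\<mu>\<bar> < \<bar>D\<bar>\<close> and \<open>\<mu> < - \<bar>D\<bar>\<close>
  (\<open>regime_iff\<close>).

  \<^emph>\<open>Components.\<close> A wavenumber \<open>k\<close> with \<open>k\<^sup>2 \<noteq> \<mu>\<close> carries an angle iff \<open>\<bar>D\<bar> \<le> \<bar>\<mu> - k\<^sup>2\<bar>\<close>, that is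
  \<open>k\<^sup>2 \<le> \<mu> - \<bar>D\<bar>\<close> or \<open>k\<^sup>2 \<ge> \<mu> + \<bar>D\<bar>\<close>. This leaves a bounded interval and two half-lines in the
  supercritical regime, the half-lines alone in the subcritical one, and the whole line in the
  subsubcritical one. Over each such interval lie two sheets \<open>\<theta> = \<plusminus>arccos (D / (\<mu> - k\<^sup>2))\<close>. They
  meet exactly where the cosine is \<open>\<plusminus>1\<close>, which for \<open>D \<noteq> 0\<close> happens at every endpoint of the
  interval, so that an interval with an endpoint contributes one component
  (\<open>connected_angles_over\<close>). Over the whole line in the subsubcritical regime the cosine stays
  strictly between \<open>-1\<close> and \<open>1\<close>, and the two sheets are the two components.

  \<^emph>\<open>Bifurcations.\<close> A homogeneous wavetrain with \<open>sin \<theta> \<noteq> 0\<close> solves the equation iff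
  \<open>\<omega> = - \<beta> / \<alpha>\<close> and \<open>\<mu> cos \<theta> = D\<close>, and so some such wavetrain exists iff \<open>\<bar>\<mu>\<bar> > \<bar>D\<bar>\<close> (when
  \<open>D \<noteq> 0\<close>). As \<open>\<mu>\<close> approaches \<open>\<epsilon> D\<close>, its third component \<open>D / \<mu>\<close> tends to \<open>\<epsilon>\<close>: it collapses to
  the very pole that exchanges stability there (\<open>solutions_emerge_at_pole\<close>). Leaving the
  subcritical regime thus always creates homogeneous wavetrains. The direction decides the type: the pole with
  \<open>\<epsilon> D = \<bar>D\<bar>\<close> loses stability as \<open>\<mu>\<close> increases through \<open>\<bar>D\<bar>\<close>, while the pole with
  \<open>\<epsilon> D = - \<bar>D\<bar>\<close> gains stability as \<open>\<mu>\<close> decreases through \<open>- \<bar>D\<bar>\<close>.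
\<close>

section \<open>Classical partial derivatives\<close>

lemma has_partials_unique:
  assumes "has_partials u ut uxx" "has_partials u ut' uxx'"
  shows "ut x t = ut' x t" "uxx x t = uxx' x t"
proof -
  obtain ux where ux: "\<And>x t. ((\<lambda>y. u y t) has_vector_derivative ux x t) (at x)"
     "\<And>x t. ((\<lambda>y. ux y t) has_vector_derivative uxx x t) (at x)"
    and ut: "\<And>x t. ((\<lambda>s. u x s) has_vector_derivative ut x t) (at t)"
    using assms(1) unfolding has_partials_def by blast
  obtain ux' where ux': "\<And>x t. ((\<lambda>y. u y t) has_vector_derivative ux' x t) (at x)"
     "\<And>x t. ((\<lambda>y. ux' y t) has_vector_derivative uxx' x t) (at x)"
    and ut': "\<And>x t. ((\<lambda>s. u x s) has_vector_derivative ut' x t) (at t)"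
    using assms(2) unfolding has_partials_def by blast
  show "ut x t = ut' x t"
    using ut ut' vector_derivative_unique_at by blast
  have "ux = ux'"
    using ux(1) ux'(1) vector_derivative_unique_at by blast
  then show "uxx x t = uxx' x t"
    using ux(2) ux'(2) vector_derivative_unique_at by blast
qed

text \<open>Composing the exponential with a bounded linear map \<open>G\<close> covers the real and the
  imaginary part of a vector-valued Fourier mode at once.\<close>

lemma has_partials_wave:
  fixes G :: "complex \<Rightarrow> real^3" and \<xi> :: real and \<nu> :: complex
  defines "E \<equiv> \<lambda>x t. exp (\<nu> * complex_of_real t + \<i> * complex_of_real (\<xi> * x))"
  assumes "bounded_linear G"
  shows "has_partials (\<lambda>x t. G (E x t)) (\<lambda>x t. G (\<nu> * E x t)) (\<lambda>x t. G (- (\<xi>\<^sup>2 *\<^sub>R E x t)))"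
proof -
  have Et: "((\<lambda>s. E x s) has_vector_derivative \<nu> * E x t) (at t)" for x t
    unfolding E_def
    by (rule derivative_eq_intros has_vector_derivative_real_field refl | simp)+
  have Ex: "((\<lambda>y. c * E y t) has_vector_derivative c * (\<i> * \<xi> * E x t)) (at x)" for c x t
    unfolding E_def of_real_mult
    by (rule derivative_eq_intros has_vector_derivative_real_field refl | simp)+
  have "((\<lambda>y. G (E y t)) has_vector_derivative G (\<i> * \<xi> * E x t)) (at x)" for x t
    using bounded_linear.has_vector_derivative[OF assms(2) Ex[of 1]] by simp
  moreover have "\<i> * \<xi> * (\<i> * \<xi> * z) = - (\<xi>\<^sup>2 *\<^sub>R z)" for z
    by (simp add: complex_eq_iff power2_eq_square)
  then have "((\<lambda>y. G (\<i> * \<xi> * E y t)) has_vector_derivative G (- (\<xi>\<^sup>2 *\<^sub>R E x t))) (at x)" for x t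
    using bounded_linear.has_vector_derivative[OF assms(2) Ex[of "\<i> * \<xi>"]]
    by simp
  ultimately show ?thesis
    unfolding has_partials_def
    using bounded_linear.has_vector_derivative[OF assms(2) Et]
    by (intro conjI exI[of _ "\<lambda>x t. G (\<i> * \<xi> * E x t)"]) simp_all
qed

section \<open>Fourier modes of the linearization at a pole\<close>

text \<open>The coefficient of \<open>s\<close> in the expansion of the right-hand side at \<open>\<epsilon> e\<^sub>3 + s v\<close>. The variation
  \<open>\<mu> v\<^sub>3 e\<^sub>3\<close> of the anisotropy term is parallel to the pole, so its cross product with the pole
  does not appear.\<close>

definition linearized_rhs ::
    "real \<Rightarrow> real \<Rightarrow> real \<Rightarrow> real \<Rightarrow> real \<Rightarrow> real^3 \<Rightarrow> real^3 \<Rightarrow> real^3 \<Rightarrow> real^3" where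
  "linearized_rhs \<alpha> \<beta> h \<mu> \<epsilon> v p q =
     (\<mu> * \<epsilon> - h) *\<^sub>R cross3 v e3 + \<epsilon> *\<^sub>R cross3 e3 (\<alpha> *\<^sub>R p - q + \<beta> *\<^sub>R cross3 v e3)"

text \<open>The right-hand side is a cross product of two factors affine in \<open>s\<close>, and at \<open>s = 0\<close> the second
  factor is parallel to the pole. It is therefore exactly quadratic in \<open>s\<close> without constant term,
  and its derivative at \<open>0\<close> can be read off.\<close>

lemma llgs_rhs_expansion:
  "llgs_rhs \<alpha> \<beta> h \<mu> (\<epsilon> *\<^sub>R e3 + s *\<^sub>R v) (s *\<^sub>R p) (s *\<^sub>R q) =
     s *\<^sub>R linearized_rhs \<alpha> \<beta> h \<mu> \<epsilon> v p q +
     s\<^sup>2 *\<^sub>R cross3 v (\<alpha> *\<^sub>R p - q + (\<mu> * v $ 3) *\<^sub>R e3 + \<beta> *\<^sub>R cross3 v e3)"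
  unfolding llgs_rhs_def linearized_rhs_def
  by (simp add: vec_eq_iff forall_3 cross3_def axis_def power2_eq_square) (simp add: algebra_simps)

lemma linearized_solution_iff:
  assumes "\<epsilon> \<noteq> 0"
  shows "linearized_solution \<alpha> \<beta> h \<mu> (\<epsilon> *\<^sub>R e3) v \<longleftrightarrow>
     (\<forall>x t. v x t $ 3 = 0) \<and>
     (\<exists>vt vxx. has_partials v vt vxx \<and>
        (\<forall>x t. vt x t = linearized_rhs \<alpha> \<beta> h \<mu> \<epsilon> (v x t) (vt x t) (vxx x t)))"
proof -
  have deriv: "((\<lambda>s. llgs_rhs \<alpha> \<beta> h \<mu> (\<epsilon> *\<^sub>R e3 + s *\<^sub>R a) (s *\<^sub>R p) (s *\<^sub>R q))
      has_vector_derivative linearized_rhs \<alpha> \<beta> h \<mu> \<epsilon> a p q) (at 0)" for a p q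
    unfolding llgs_rhs_expansion
    by (rule derivative_eq_intros refl | simp)+
  have "((\<lambda>s. llgs_rhs \<alpha> \<beta> h \<mu> (\<epsilon> *\<^sub>R e3 + s *\<^sub>R a) (s *\<^sub>R p) (s *\<^sub>R q))
       has_vector_derivative p) (at 0) \<longleftrightarrow> p = linearized_rhs \<alpha> \<beta> h \<mu> \<epsilon> a p q" (is "?l \<longleftrightarrow> ?r")
    for a p q
  proof
    assume ?l
    then show ?r
      by (rule vector_derivative_unique_at[OF _ deriv])
  next
    assume r: ?r
    show ?l
      by (subst (2) r) (rule deriv)
  qed
  moreover have "inner (\<epsilon> *\<^sub>R e3) a = 0 \<longleftrightarrow> a $ 3 = 0" for a :: "real^3"
    using assms by (simp add: inner_axis' )
  ultimately show ?thesis
    unfolding linearized_solution_def by simp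
qed

text \<open>The first line on the right says that the field and its time derivative are tangential; the
  other two are the tangential components of the linearized equation, whose coefficients are real and
  therefore commute with \<open>g\<close>. Here \<open>g\<close> stands for \<open>Re\<close> or \<open>Im\<close>.\<close>

lemma linearized_solution_wave_iff:
  fixes V :: "complex^3" and g :: "complex \<Rightarrow> real" and \<xi> :: real and \<nu> :: complex
  defines "E \<equiv> \<lambda>x t. exp (\<nu> * complex_of_real t + \<i> * complex_of_real (\<xi> * x))"
  assumes "\<epsilon> \<noteq> 0" "bounded_linear g"
  shows "linearized_solution \<alpha> \<beta> h \<mu> (\<epsilon> *\<^sub>R e3) (\<lambda>x t. \<chi> j. g (E x t * V $ j)) \<longleftrightarrow>
     (\<forall>x t. g (E x t * V $ 3) = 0 \<and> g (E x t * (\<nu> * V $ 3)) = 0 \<and>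
        g (E x t * (\<nu> * V$1 - ((\<mu> * \<epsilon> - h) *\<^sub>R V$2
             - \<epsilon> *\<^sub>R (\<alpha> *\<^sub>R (\<nu> * V$2) + \<xi>\<^sup>2 *\<^sub>R V$2 - \<beta> *\<^sub>R V$1)))) = 0 \<and>
        g (E x t * (\<nu> * V$2 - (- (\<mu> * \<epsilon> - h) *\<^sub>R V$1
             + \<epsilon> *\<^sub>R (\<alpha> *\<^sub>R (\<nu> * V$1) + \<xi>\<^sup>2 *\<^sub>R V$1 + \<beta> *\<^sub>R V$2)))) = 0)"
    (is "_ \<longleftrightarrow> (\<forall>x t. ?Q x t)")
proof -
  interpret g: bounded_linear g by fact
  note neg = linear_neg[OF g.linear_axioms]
  define G where "G z = (\<chi> j. g (z * V $ j))" for z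
  have "linear G"
    unfolding G_def
    by (rule linearI) (simp_all add: vec_eq_iff g.add g.scaleR distrib_right)
  then have "bounded_linear G"
    by (simp add: linear_conv_bounded_linear)
  then have part: "has_partials (\<lambda>x t. G (E x t)) (\<lambda>x t. G (\<nu> * E x t)) (\<lambda>x t. G (- (\<xi>\<^sup>2 *\<^sub>R E x t)))"
    unfolding E_def by (rule has_partials_wave)
  have eq: "G (E x t) $ 3 = 0 \<and>
      G (\<nu> * E x t) = linearized_rhs \<alpha> \<beta> h \<mu> \<epsilon> (G (E x t)) (G (\<nu> * E x t)) (G (- (\<xi>\<^sup>2 *\<^sub>R E x t)))
      \<longleftrightarrow> ?Q x t" for x t
  proof -
    define L where
      "L = linearized_rhs \<alpha> \<beta> h \<mu> \<epsilon> (G (E x t)) (G (\<nu> * E x t)) (G (- (\<xi>\<^sup>2 *\<^sub>R E x t)))"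
    have L: "L $ 1 = (\<mu> * \<epsilon> - h) * G (E x t) $ 2
        - \<epsilon> * (\<alpha> * G (\<nu> * E x t) $ 2 - G (- (\<xi>\<^sup>2 *\<^sub>R E x t)) $ 2 - \<beta> * G (E x t) $ 1)"
      "L $ 2 = - (\<mu> * \<epsilon> - h) * G (E x t) $ 1
        + \<epsilon> * (\<alpha> * G (\<nu> * E x t) $ 1 - G (- (\<xi>\<^sup>2 *\<^sub>R E x t)) $ 1 + \<beta> * G (E x t) $ 2)"
      "L $ 3 = 0"
      unfolding L_def linearized_rhs_def by (simp_all add: cross3_def axis_def algebra_simps)
    have G: "G (\<nu> * E x t) $ j = g (E x t * (\<nu> * V $ j))"
      "G (- (\<xi>\<^sup>2 *\<^sub>R E x t)) $ j = - (\<xi>\<^sup>2 * g (E x t * V $ j))"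
      "G (E x t) $ j = g (E x t * V $ j)" for j
      unfolding G_def by (simp_all add: neg g.scaleR mult_ac)
    have "g (E x t * (\<nu> * V$1 - ((\<mu> * \<epsilon> - h) *\<^sub>R V$2
             - \<epsilon> *\<^sub>R (\<alpha> *\<^sub>R (\<nu> * V$2) + \<xi>\<^sup>2 *\<^sub>R V$2 - \<beta> *\<^sub>R V$1)))) = G (\<nu> * E x t) $ 1 - L $ 1"
      unfolding L G
      by (simp only: right_diff_distrib distrib_left mult_scaleR_right g.add g.diff g.scaleR)
        (simp add: algebra_simps)
    moreover have "g (E x t * (\<nu> * V$2 - (- (\<mu> * \<epsilon> - h) *\<^sub>R V$1
             + \<epsilon> *\<^sub>R (\<alpha> *\<^sub>R (\<nu> * V$1) + \<xi>\<^sup>2 *\<^sub>R V$1 + \<beta> *\<^sub>R V$2)))) = G (\<nu> * E x t) $ 2 - L $ 2"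
      unfolding L G
      by (simp only: right_diff_distrib distrib_left mult_scaleR_right g.add g.diff g.scaleR)
        (simp add: algebra_simps)
    moreover have "G (\<nu> * E x t) = L \<longleftrightarrow>
        G (\<nu> * E x t) $ 3 = 0 \<and> G (\<nu> * E x t) $ 1 - L $ 1 = 0 \<and> G (\<nu> * E x t) $ 2 - L $ 2 = 0"
      by (auto simp: vec_eq_iff forall_3 L(3))
    ultimately show ?thesis
      unfolding L_def[symmetric] by (simp only: G)
  qed
  have "(\<exists>vt vxx. has_partials (\<lambda>x t. G (E x t)) vt vxx \<and>
          (\<forall>x t. vt x t = linearized_rhs \<alpha> \<beta> h \<mu> \<epsilon> (G (E x t)) (vt x t) (vxx x t))) \<longleftrightarrow>
      (\<forall>x t. G (\<nu> * E x t) =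
         linearized_rhs \<alpha> \<beta> h \<mu> \<epsilon> (G (E x t)) (G (\<nu> * E x t)) (G (- (\<xi>\<^sup>2 *\<^sub>R E x t))))"
    (is "?L \<longleftrightarrow> ?R")
  proof
    assume ?L
    then obtain vt vxx where v: "has_partials (\<lambda>x t. G (E x t)) vt vxx"
      and eqn: "\<And>x t. vt x t = linearized_rhs \<alpha> \<beta> h \<mu> \<epsilon> (G (E x t)) (vt x t) (vxx x t)"
      by blast
    show ?R
      using eqn unfolding has_partials_unique[OF v part] by blast
  next
    assume ?R
    then show ?L
      using part by blast
  qed
  then have "linearized_solution \<alpha> \<beta> h \<mu> (\<epsilon> *\<^sub>R e3) (\<lambda>x t. G (E x t)) \<longleftrightarrow> (\<forall>x t. ?Q x t)"
    unfolding linearized_solution_iff[OF assms(2)] eq[symmetric] by (simp add: all_conj_distrib)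
  then show ?thesis
    unfolding G_def .
qed


text \<open>Taken together, the real and the imaginary parts of a mode say that \<open>(V\<^sub>1, V\<^sub>2)\<close> is in the kernel
  of the matrix with rows \<open>(d, -c)\<close> and \<open>(c, d)\<close>, where \<open>d\<close> and \<open>c\<close> are the two quantities squared
  in the statement. The determinant is \<open>d\<^sup>2 + c\<^sup>2 = (d - \<i> c) (d + \<i> c)\<close>, and when it vanishes one of
  the circularly polarized vectors \<open>(1, \<plusminus>\<i>, 0)\<close> lies in the kernel.\<close>

lemma fourier_mode_iff_characteristic:
  assumes "\<epsilon> \<noteq> 0"
  shows "fourier_mode \<alpha> \<beta> h \<mu> (\<epsilon> *\<^sub>R e3) \<xi> \<nu> \<longleftrightarrow>
    (\<nu> - \<epsilon> * \<beta>)\<^sup>2 + (\<mu> * \<epsilon> - h - \<epsilon> * (\<alpha> * \<nu> + \<xi>\<^sup>2))\<^sup>2 = 0"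
proof -
  define E where "E x t = exp (\<nu> * complex_of_real t + \<i> * complex_of_real (\<xi> * x))" for x t
  define c where "c = \<mu> * \<epsilon> - h - \<epsilon> * (\<alpha> * \<nu> + \<xi>\<^sup>2)"
  define d where "d = \<nu> - \<epsilon> * \<beta>"
  have E0: "E 0 0 = 1"
    unfolding E_def by simp
  note iff = linearized_solution_wave_iff[OF assms, where \<nu> = \<nu> and \<xi> = \<xi>, folded E_def]
  \<comment> \<open>The exponential is \<open>1\<close> at \<open>x = t = 0\<close>.\<close>
  have all: "(\<forall>x t. Re (E x t * z) = 0) \<and> (\<forall>x t. Im (E x t * z) = 0) \<longleftrightarrow> z = 0" for z
    by (metis E0 complex_eq_iff mult_1 mult_zero_right zero_complex.sel)
  have eq1: "\<nu> * V$1 - ((\<mu> * \<epsilon> - h) *\<^sub>R V$2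
             - \<epsilon> *\<^sub>R (\<alpha> *\<^sub>R (\<nu> * V$2) + \<xi>\<^sup>2 *\<^sub>R V$2 - \<beta> *\<^sub>R V$1)) = d * V$1 - c * V$2"
    and eq2: "\<nu> * V$2 - (- (\<mu> * \<epsilon> - h) *\<^sub>R V$1
             + \<epsilon> *\<^sub>R (\<alpha> *\<^sub>R (\<nu> * V$1) + \<xi>\<^sup>2 *\<^sub>R V$1 + \<beta> *\<^sub>R V$2)) = d * V$2 + c * V$1"
    for V :: "complex^3"
    unfolding c_def d_def by (simp_all add: scaleR_conv_of_real algebra_simps)
  have "fourier_mode \<alpha> \<beta> h \<mu> (\<epsilon> *\<^sub>R e3) \<xi> \<nu> \<longleftrightarrow>
     (\<exists>V :: complex^3. V \<noteq> 0 \<and> V$3 = 0 \<and> \<nu> * V$3 = 0 \<and> d * V$1 - c * V$2 = 0 \<and> d * V$2 + c * V$1 = 0)"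
    unfolding fourier_mode_def E_def[symmetric] iff[OF bounded_linear_Re] iff[OF bounded_linear_Im]
      eq1 eq2 all[symmetric] by (intro iff_exI) blast
  also have "\<dots> \<longleftrightarrow> d\<^sup>2 + c\<^sup>2 = 0"
  proof
    assume "\<exists>V :: complex^3. V \<noteq> 0 \<and> V$3 = 0 \<and> \<nu> * V$3 = 0 \<and> d * V$1 - c * V$2 = 0 \<and> d * V$2 + c * V$1 = 0"
    then obtain V :: "complex^3" where V: "V \<noteq> 0" "V$3 = 0"
      and 1: "d * V$1 - c * V$2 = 0" and 2: "d * V$2 + c * V$1 = 0"
      by blast
    from V have "V$1 \<noteq> 0 \<or> V$2 \<noteq> 0"
      by (simp add: vec_eq_iff forall_3)
    moreover have "(d\<^sup>2 + c\<^sup>2) * V$1 = d * (d * V$1 - c * V$2) + c * (d * V$2 + c * V$1)"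
      "(d\<^sup>2 + c\<^sup>2) * V$2 = d * (d * V$2 + c * V$1) - c * (d * V$1 - c * V$2)"
      by (simp_all add: power2_eq_square algebra_simps)
    ultimately show "d\<^sup>2 + c\<^sup>2 = 0"
      unfolding 1 2 by auto
  next
    assume "d\<^sup>2 + c\<^sup>2 = 0"
    then have "(d - \<i> * c) * (d + \<i> * c) = 0"
      by (simp add: power2_eq_square algebra_simps)
    then consider "d = \<i> * c" | "d = - \<i> * c"
      by (auto simp: add_eq_0_iff)
    then show "\<exists>V :: complex^3. V \<noteq> 0 \<and> V$3 = 0 \<and> \<nu> * V$3 = 0 \<and> d * V$1 - c * V$2 = 0 \<and> d * V$2 + c * V$1 = 0"
    proof cases
      case 1
      then show ?thesis
        by (intro exI[of _ "vector [1, \<i>, 0]"]) (auto simp: vec_eq_iff forall_3 algebra_simps)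
    next
      case 2
      then show ?thesis
        by (intro exI[of _ "vector [1, - \<i>, 0]"]) (auto simp: vec_eq_iff forall_3 algebra_simps)
    qed
  qed
  finally show ?thesis
    unfolding c_def d_def .
qed

text \<open>The rate of \<open>v\<^sub>1 + \<i> v\<^sub>2\<close> in \<open>(\<alpha> + \<i> \<epsilon>) v\<^sub>t = v\<^sub>x\<^sub>x + (\<mu> - \<epsilon> h + \<i> \<beta>) v\<close>.\<close>

definition growth_rate :: "real \<Rightarrow> real \<Rightarrow> real \<Rightarrow> real \<Rightarrow> real \<Rightarrow> real \<Rightarrow> complex" where
  "growth_rate \<alpha> \<beta> h \<mu> \<epsilon> \<xi> = Complex (\<mu> - \<xi>\<^sup>2 - \<epsilon> * h) \<beta> / Complex \<alpha> \<epsilon>"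

text \<open>For \<open>\<epsilon>\<^sup>2 = 1\<close> the characteristic polynomial splits into two linear factors, one for the equation
  satisfied by \<open>v\<^sub>1 + \<i> v\<^sub>2\<close> and one for its complex conjugate.\<close>

lemma fourier_mode_iff:
  assumes "\<epsilon>\<^sup>2 = 1"
  shows "fourier_mode \<alpha> \<beta> h \<mu> (\<epsilon> *\<^sub>R e3) \<xi> \<nu> \<longleftrightarrow>
     \<nu> = growth_rate \<alpha> \<beta> h \<mu> \<epsilon> \<xi> \<or> \<nu> = cnj (growth_rate \<alpha> \<beta> h \<mu> \<epsilon> \<xi>)"
proof -
  have e: "\<epsilon> \<noteq> 0" "\<epsilon> * \<epsilon> = 1" "\<And>z::complex. of_real \<epsilon> * (of_real \<epsilon> * z) = z"
    using assms by (auto simp: power2_eq_square simp flip: mult.assoc of_real_mult)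
  \<comment> \<open>The two linear factors, vanishing at the growth rate and at its conjugate.\<close>
  define p where "p = Complex \<alpha> \<epsilon> * \<nu> - Complex (\<mu> - \<xi>\<^sup>2 - \<epsilon> * h) \<beta>"
  define q where "q = Complex \<alpha> (- \<epsilon>) * \<nu> - Complex (\<mu> - \<xi>\<^sup>2 - \<epsilon> * h) (- \<beta>)"
  have nz: "Complex \<alpha> \<epsilon> \<noteq> 0" "Complex \<alpha> (- \<epsilon>) \<noteq> 0"
    using e(1) by (auto simp: complex_eq_iff)
  have "p = 0 \<longleftrightarrow> \<nu> = growth_rate \<alpha> \<beta> h \<mu> \<epsilon> \<xi>"
    unfolding p_def growth_rate_def using nz by (simp add: field_simps)
  moreover have "q = 0 \<longleftrightarrow> \<nu> = cnj (growth_rate \<alpha> \<beta> h \<mu> \<epsilon> \<xi>)"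
    unfolding q_def growth_rate_def using nz by (simp add: field_simps complex_cnj)
  moreover have "(\<nu> - \<epsilon> * \<beta>)\<^sup>2 + (\<mu> * \<epsilon> - h - \<epsilon> * (\<alpha> * \<nu> + \<xi>\<^sup>2))\<^sup>2 = p * q"
  proof -
    define a where "a = \<alpha> * \<nu> - (\<mu> - \<xi>\<^sup>2 - \<epsilon> * h)"
    define b where "b = \<epsilon> * \<nu> - \<beta>"
    have "p = a + \<i> * b" "q = a - \<i> * b"
      unfolding p_def q_def a_def b_def by (simp_all add: complex_eq_iff algebra_simps)
    then have "p * q = a\<^sup>2 + b\<^sup>2"
      by (simp only:) (simp add: power2_eq_square algebra_simps)
    moreover have "\<nu> - \<epsilon> * \<beta> = \<epsilon> * b"
      unfolding b_def by (simp add: right_diff_distrib e(3))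
    moreover have "\<mu> * \<epsilon> - h - \<epsilon> * (\<alpha> * \<nu> + \<xi>\<^sup>2) = - (\<epsilon> * a)"
      unfolding a_def by (simp add: right_diff_distrib distrib_left e(3))
    moreover have "(\<epsilon> * z)\<^sup>2 = z\<^sup>2" for z :: complex
      by (simp add: power2_eq_square mult.left_commute e(3))
    ultimately show ?thesis
      by (simp del: of_real_diff of_real_mult of_real_add)
  qed
  ultimately show ?thesis
    unfolding fourier_mode_iff_characteristic[OF e(1)] by auto
qed

lemma Re_growth_rate:
  assumes "\<alpha> > 0" "\<epsilon>\<^sup>2 = 1"
  shows "Re (growth_rate \<alpha> \<beta> h \<mu> \<epsilon> \<xi>) = \<alpha> / (1 + \<alpha>\<^sup>2) * (\<mu> - \<epsilon> * (h - \<beta> / \<alpha>) - \<xi>\<^sup>2)"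
proof -
  have "Re (growth_rate \<alpha> \<beta> h \<mu> \<epsilon> \<xi>) = (\<alpha> * (\<mu> - \<xi>\<^sup>2 - \<epsilon> * h) + \<beta> * \<epsilon>) / (1 + \<alpha>\<^sup>2)"
    using assms by (simp add: growth_rate_def Re_divide algebra_simps)
  also have "\<alpha> * (\<mu> - \<xi>\<^sup>2 - \<epsilon> * h) + \<beta> * \<epsilon> = \<alpha> * (\<mu> - \<epsilon> * (h - \<beta> / \<alpha>) - \<xi>\<^sup>2)"
    using assms by (simp add: field_simps)
  finally show ?thesis
    by simp
qed

lemma Im_growth_rate_threshold:
  assumes "\<alpha> > 0" "\<epsilon>\<^sup>2 = 1"
  shows "Im (growth_rate \<alpha> \<beta> h (\<epsilon> * (h - \<beta> / \<alpha>)) \<epsilon> 0) = \<beta> / \<alpha>"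
proof -
  have "\<epsilon> * (\<epsilon> * \<beta>) = \<beta>"
    using assms(2) by (simp add: power2_eq_square flip: mult.assoc)
  then have "\<beta> * \<alpha> - (\<epsilon> * (h - \<beta> / \<alpha>) - \<epsilon> * h) * \<epsilon> = \<beta> / \<alpha> * (1 + \<alpha>\<^sup>2)"
    using assms(1) by (simp add: field_simps power2_eq_square)
  moreover have "1 + \<alpha>\<^sup>2 \<noteq> 0"
    by (simp add: add_nonneg_eq_0_iff)
  ultimately show ?thesis
    using assms by (simp add: growth_rate_def Im_divide add.commute)
qed

section \<open>Stability of the poles and the anisotropy regimes\<close>

text \<open>The real part of the growth rate is largest at \<open>\<xi> = 0\<close>; a negative value there is
  a bound for the whole spectrum.\<close>

lemma strictly_stable_iff:
  assumes "\<alpha> > 0" "\<epsilon>\<^sup>2 = 1"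
  shows "strictly_stable \<alpha> \<beta> h \<mu> (\<epsilon> *\<^sub>R e3) \<longleftrightarrow> \<mu> < \<epsilon> * (h - \<beta> / \<alpha>)"
proof -
  have pos: "\<alpha> / (1 + \<alpha>\<^sup>2) > 0"
    using assms(1) by (simp add: add_pos_nonneg)
  have "strictly_stable \<alpha> \<beta> h \<mu> (\<epsilon> *\<^sub>R e3) \<longleftrightarrow>
      (\<exists>\<delta>>0. \<forall>\<xi>. \<alpha> / (1 + \<alpha>\<^sup>2) * (\<mu> - \<epsilon> * (h - \<beta> / \<alpha>) - \<xi>\<^sup>2) \<le> - \<delta>)"
    unfolding strictly_stable_def spectrum_def fourier_mode_iff[OF assms(2)]
      Re_growth_rate[OF assms, symmetric] by fastforce
  also have "\<dots> \<longleftrightarrow> \<mu> < \<epsilon> * (h - \<beta> / \<alpha>)"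
  proof
    assume "\<exists>\<delta>>0. \<forall>\<xi>. \<alpha> / (1 + \<alpha>\<^sup>2) * (\<mu> - \<epsilon> * (h - \<beta> / \<alpha>) - \<xi>\<^sup>2) \<le> - \<delta>"
    then have "\<alpha> / (1 + \<alpha>\<^sup>2) * (\<mu> - \<epsilon> * (h - \<beta> / \<alpha>) - 0\<^sup>2) < 0"
      by (metis neg_less_0_iff_less order_le_less_trans)
    then show "\<mu> < \<epsilon> * (h - \<beta> / \<alpha>)"
      using pos by (simp only: mult_less_0_iff) simp
  next
    assume "\<mu> < \<epsilon> * (h - \<beta> / \<alpha>)"
    then have "\<alpha> / (1 + \<alpha>\<^sup>2) * (\<epsilon> * (h - \<beta> / \<alpha>) - \<mu>) > 0"
      using pos by (intro mult_pos_pos) auto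
    moreover have "\<alpha> / (1 + \<alpha>\<^sup>2) * (\<mu> - \<epsilon> * (h - \<beta> / \<alpha>) - \<xi>\<^sup>2)
        \<le> - (\<alpha> / (1 + \<alpha>\<^sup>2) * (\<epsilon> * (h - \<beta> / \<alpha>) - \<mu>))" for \<xi> :: real
      unfolding mult_minus_right[symmetric] using pos by (intro mult_left_mono) auto
    ultimately show "\<exists>\<delta>>0. \<forall>\<xi>. \<alpha> / (1 + \<alpha>\<^sup>2) * (\<mu> - \<epsilon> * (h - \<beta> / \<alpha>) - \<xi>\<^sup>2) \<le> - \<delta>"
      by blast
  qed
  finally show ?thesis .
qed

lemma unstable_iff:
  assumes "\<alpha> > 0" "\<epsilon>\<^sup>2 = 1"
  shows "unstable \<alpha> \<beta> h \<mu> (\<epsilon> *\<^sub>R e3) \<longleftrightarrow> \<mu> > \<epsilon> * (h - \<beta> / \<alpha>)"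
proof -
  have pos: "\<alpha> / (1 + \<alpha>\<^sup>2) > 0"
    using assms(1) by (simp add: add_pos_nonneg)
  have "unstable \<alpha> \<beta> h \<mu> (\<epsilon> *\<^sub>R e3) \<longleftrightarrow> (\<exists>\<xi>. Re (growth_rate \<alpha> \<beta> h \<mu> \<epsilon> \<xi>) > 0)"
    unfolding unstable_def spectrum_def fourier_mode_iff[OF assms(2)] by fastforce
  also have "\<dots> \<longleftrightarrow> (\<exists>\<xi>::real. \<mu> - \<epsilon> * (h - \<beta> / \<alpha>) - \<xi>\<^sup>2 > 0)"
    unfolding Re_growth_rate[OF assms] using pos by (simp only: zero_less_mult_iff) auto
  also have "\<dots> \<longleftrightarrow> \<mu> > \<epsilon> * (h - \<beta> / \<alpha>)"
  proof
    assume "\<exists>\<xi>::real. \<mu> - \<epsilon> * (h - \<beta> / \<alpha>) - \<xi>\<^sup>2 > 0"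
    then obtain \<xi> :: real where "\<mu> - \<epsilon> * (h - \<beta> / \<alpha>) - \<xi>\<^sup>2 > 0" ..
    then show "\<mu> > \<epsilon> * (h - \<beta> / \<alpha>)"
      using zero_le_power2[of \<xi>] by linarith
  qed (auto intro: exI[of _ 0])
  finally show ?thesis .
qed

text \<open>At \<open>\<mu> = \<epsilon> D\<close> the real part of the rate is a negative multiple of \<open>\<xi>\<^sup>2\<close>, so only \<open>\<xi> = 0\<close> is
  critical; there the rate is \<open>\<i> \<beta> / \<alpha>\<close>, and \<open>\<beta> \<noteq> 0\<close> keeps the conjugate pair apart.\<close>

lemma hopf_threshold_at_marginal_anisotropy:
  assumes "\<alpha> > 0" "\<epsilon>\<^sup>2 = 1" "\<beta> \<noteq> 0"
  shows "hopf_threshold \<alpha> \<beta> h (\<epsilon> * (h - \<beta> / \<alpha>)) (\<epsilon> *\<^sub>R e3)"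
proof -
  define \<mu> where "\<mu> = \<epsilon> * (h - \<beta> / \<alpha>)"
  have pos: "\<alpha> / (1 + \<alpha>\<^sup>2) > 0"
    using assms(1) by (simp add: add_pos_nonneg)
  have Re: "Re (growth_rate \<alpha> \<beta> h \<mu> \<epsilon> \<xi>) = - (\<alpha> / (1 + \<alpha>\<^sup>2) * \<xi>\<^sup>2)" for \<xi>
    unfolding Re_growth_rate[OF assms(1,2)] \<mu>_def by simp
  have Re0: "Re (growth_rate \<alpha> \<beta> h \<mu> \<epsilon> \<xi>) = 0 \<longleftrightarrow> \<xi> = 0" for \<xi>
    unfolding Re using pos by (simp only: neg_equal_0_iff_equal mult_eq_0_iff) auto
  have critical: "growth_rate \<alpha> \<beta> h \<mu> \<epsilon> 0 = Complex 0 (\<beta> / \<alpha>)"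
    using Im_growth_rate_threshold[OF assms(1,2), of \<beta> h] Re[of 0]
    by (simp add: \<mu>_def complex_eq_iff)
  have "{(\<xi>, \<nu>). fourier_mode \<alpha> \<beta> h \<mu> (\<epsilon> *\<^sub>R e3) \<xi> \<nu> \<and> Re \<nu> = 0} =
      {(0, Complex 0 (\<beta> / \<alpha>)), (0, Complex 0 (- (\<beta> / \<alpha>)))}"
  proof -
    have "fourier_mode \<alpha> \<beta> h \<mu> (\<epsilon> *\<^sub>R e3) \<xi> \<nu> \<and> Re \<nu> = 0 \<longleftrightarrow>
        \<xi> = 0 \<and> (\<nu> = Complex 0 (\<beta> / \<alpha>) \<or> \<nu> = Complex 0 (- (\<beta> / \<alpha>)))" for \<xi> \<nu>
      unfolding fourier_mode_iff[OF assms(2)]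
      using Re0[of \<xi>] critical by (auto simp: complex_cnj)
    then show ?thesis
      by auto
  qed
  also have "\<dots> = {(0, Complex 0 \<bar>\<beta> / \<alpha>\<bar>), (0, Complex 0 (- \<bar>\<beta> / \<alpha>\<bar>))}"
    by (cases "\<beta> / \<alpha> \<ge> 0") auto
  finally have "\<exists>\<omega>>0. {(\<xi>, \<nu>). fourier_mode \<alpha> \<beta> h \<mu> (\<epsilon> *\<^sub>R e3) \<xi> \<nu> \<and> Re \<nu> = 0} =
      {(0, Complex 0 \<omega>), (0, Complex 0 (- \<omega>))}"
    using assms(1,3) by (intro exI[of _ "\<bar>\<beta> / \<alpha>\<bar>"]) simp
  moreover have "Re (growth_rate \<alpha> \<beta> h \<mu> \<epsilon> \<xi>) \<le> 0" for \<xi>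
    unfolding Re using pos by (simp only: neg_le_0_iff_le) (intro mult_nonneg_nonneg; simp)
  ultimately show ?thesis
    unfolding hopf_threshold_def spectrum_def fourier_mode_iff[OF assms(2)] \<mu>_def[symmetric]
    by auto
qed

lemma e3_stability:
  assumes "\<alpha> > 0"
  shows "strictly_stable \<alpha> \<beta> h \<mu> e3 \<longleftrightarrow> \<mu> < h - \<beta> / \<alpha>"
    and "strictly_stable \<alpha> \<beta> h \<mu> (- e3) \<longleftrightarrow> \<mu> < - (h - \<beta> / \<alpha>)"
    and "unstable \<alpha> \<beta> h \<mu> e3 \<longleftrightarrow> \<mu> > h - \<beta> / \<alpha>"
    and "unstable \<alpha> \<beta> h \<mu> (- e3) \<longleftrightarrow> \<mu> > - (h - \<beta> / \<alpha>)"
  using strictly_stable_iff[OF assms, of 1] strictly_stable_iff[OF assms, of "- 1"]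
    unstable_iff[OF assms, of 1] unstable_iff[OF assms, of "- 1"] by simp_all

lemma regime_iff:
  assumes "\<alpha> > 0"
  shows "supercritical \<alpha> \<beta> h \<mu> \<longleftrightarrow> \<mu> > \<bar>h - \<beta> / \<alpha>\<bar>"
    and "subcritical \<alpha> \<beta> h \<mu> \<longleftrightarrow> \<bar>\<mu>\<bar> < \<bar>h - \<beta> / \<alpha>\<bar>"
    and "subsubcritical \<alpha> \<beta> h \<mu> \<longleftrightarrow> \<mu> < - \<bar>h - \<beta> / \<alpha>\<bar>"
  unfolding supercritical_def subcritical_def subsubcritical_def e3_stability[OF assms]
  by linarith+

section \<open>Connected components of the wavetrain parameters\<close>

text \<open>The complement of a piece is the union of the other pieces, so every piece is clopen and a
  connected subset that meets it cannot leave it.\<close>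

lemma components_eq_relatively_open_partition:
  assumes "\<And>A. A \<in> P \<Longrightarrow> openin (top_of_set S) A \<and> connected A \<and> A \<noteq> {}"
    and "disjoint P" and "\<Union>P = S"
  shows "components S = P"
proof -
  have comp: "connected_component_set S x = A" if "A \<in> P" "x \<in> A" for A x
  proof (rule connected_component_unique)
    show "x \<in> A" "A \<subseteq> S" "connected A"
      using that assms(1)[OF that(1)] openin_imp_subset by auto
    fix T
    assume T: "x \<in> T" "T \<subseteq> S" "connected T"
    define B where "B = \<Union>(P - {A})"
    have "openin (top_of_set S) B" "openin (top_of_set S) A"
      unfolding B_def using assms(1) that(1) by (blast intro: openin_Union)+
    then obtain U V where U: "open U" "A = S \<inter> U" and V: "open V" "B = S \<inter> V"
      unfolding openin_open by blast
    have B: "B \<inter> A = {}" "B \<union> A = S"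
      unfolding B_def using assms(2,3) that(1) by (auto simp: disjoint_def)
    have "U \<inter> V \<inter> T = {}" "T \<subseteq> U \<union> V"
      using B T(2) by (auto simp: U(2) V(2))
    then have "V \<inter> T = {}"
      using connectedD[OF T(3) U(1) V(1)] T(1) that(2) U(2) by blast
    then have "B \<inter> T = {}"
      using V(2) by blast
    then show "T \<subseteq> A"
      using T(2) B(2) by blast
  qed
  have "components S = (\<Union>A\<in>P. (\<lambda>x. connected_component_set S x) ` A)"
    unfolding components_def assms(3)[symmetric] by auto
  also have "\<dots> = (\<Union>A\<in>P. {A})"
    using comp assms(1) by (intro SUP_cong refl) (simp add: image_constant_conv cong: image_cong)
  finally show ?thesis
    by simp
qed

lemma unit_complex_iff:
  "norm z = 1 \<and> Re z = c \<longleftrightarrow>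
     \<bar>c\<bar> \<le> 1 \<and> (z = cis (arccos c) \<or> z = cis (- arccos c))"
proof
  assume z: "norm z = 1 \<and> Re z = c"
  then have c: "\<bar>c\<bar> \<le> 1"
    using abs_Re_le_cmod[of z] by simp
  have "(Re z)\<^sup>2 + (Im z)\<^sup>2 = 1"
    using z cmod_power2[of z] by simp
  then have "(Im z)\<^sup>2 = (sqrt (1 - c\<^sup>2))\<^sup>2"
    using z c by (simp add: abs_square_le_1)
  then have "Im z = sqrt (1 - c\<^sup>2) \<or> Im z = - sqrt (1 - c\<^sup>2)"
    by (simp only: power2_eq_iff)
  with z c show "\<bar>c\<bar> \<le> 1 \<and> (z = cis (arccos c) \<or> z = cis (- arccos c))"
    by (auto simp: complex_eq_iff sin_arccos)
next
  assume "\<bar>c\<bar> \<le> 1 \<and> (z = cis (arccos c) \<or> z = cis (- arccos c))"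
  then show "norm z = 1 \<and> Re z = c"
    by auto
qed

lemma wavetrain_parameters_eq:
  "wavetrain_parameters \<alpha> \<beta> h \<mu> =
     {(k, z). k\<^sup>2 \<noteq> \<mu> \<and> norm z = 1 \<and> Re z = (h - \<beta> / \<alpha>) / (\<mu> - k\<^sup>2)}"
proof -
  have "\<exists>\<theta>. z = cis \<theta>" if "norm z = 1" for z
    using that complex_norm_eq_1_exp_eq[of z] by (metis cis_conv_exp)
  then show ?thesis
    unfolding wavetrain_parameters_def by fastforce
qed

lemma continuous_on_arccos_comp:
  fixes f :: "real \<Rightarrow> real" and s :: real
  assumes "continuous_on I f" "\<And>k. k \<in> I \<Longrightarrow> \<bar>f k\<bar> \<le> 1"
  shows "continuous_on I (\<lambda>k. s * arccos (f k))"
proof -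
  have "\<forall>k\<in>I. - 1 \<le> f k \<and> f k \<le> 1"
    using assms(2) by (simp add: abs_le_iff minus_le_iff)
  then show ?thesis
    using assms(1) by (intro continuous_intros)
qed

lemma connected_arccos_graph:
  fixes f :: "real \<Rightarrow> real" and s :: real
  assumes "connected I" "continuous_on I f" "\<And>k. k \<in> I \<Longrightarrow> \<bar>f k\<bar> \<le> 1"
  shows "connected ((\<lambda>k. (k, cis (s * arccos (f k)))) ` I)"
  using connected_continuous_image[OF continuous_on_Pair[OF continuous_on_id
        continuous_on_cis[OF continuous_on_arccos_comp[OF assms(2,3)]]] assms(1)] by simp

text \<open>The unit circle is kept as the set of complex numbers of norm \<open>1\<close>, on which the cosine of the
  angle is the real part.\<close>

definition angles_over :: "(real \<Rightarrow> real) \<Rightarrow> real set \<Rightarrow> (real \<times> complex) set" where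
  "angles_over f I = {(k, z). k \<in> I \<and> norm z = 1 \<and> Re z = f k}"

lemma angles_over_eq_sheets:
  assumes "\<forall>k\<in>I. \<bar>f k\<bar> \<le> 1"
  shows "angles_over f I =
     (\<lambda>k. (k, cis (arccos (f k)))) ` I \<union> (\<lambda>k. (k, cis (- arccos (f k)))) ` I"
  using assms unfolding angles_over_def by (auto simp: unit_complex_iff simp del: cis_inverse)

lemma fst_image_angles_over:
  assumes "\<forall>k\<in>I. \<bar>f k\<bar> \<le> 1"
  shows "fst ` angles_over f I = I"
  unfolding angles_over_eq_sheets[OF assms] by (simp add: image_Un image_image)

text \<open>Each of the two sheets \<open>\<theta> = \<plusminus>arccos (f k)\<close> is a continuous image of \<open>I\<close>. They meet over
  \<open>k\<^sub>0\<close> because the angles \<open>0\<close> and \<open>\<pi>\<close> agree with their negatives modulo \<open>2 \<pi>\<close>.\<close>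

lemma connected_angles_over:
  assumes "connected I" "continuous_on I f" "\<forall>k\<in>I. \<bar>f k\<bar> \<le> 1"
    and "k\<^sub>0 \<in> I" "\<bar>f k\<^sub>0\<bar> = 1"
  shows "connected (angles_over f I)"
  unfolding angles_over_eq_sheets[OF assms(3)]
proof (rule connected_Un)
  show "connected ((\<lambda>k. (k, cis (arccos (f k)))) ` I)" "connected ((\<lambda>k. (k, cis (- arccos (f k)))) ` I)"
    using connected_arccos_graph[OF assms(1,2), of 1] connected_arccos_graph[OF assms(1,2), of "- 1"]
      assms(3) by simp_all
  have "cis (arccos (f k\<^sub>0)) = cis (- arccos (f k\<^sub>0))"
    using assms(5) by (auto simp: abs_if complex_eq_iff split: if_splits)
  then show "(\<lambda>k. (k, cis (arccos (f k)))) ` I \<inter> (\<lambda>k. (k, cis (- arccos (f k)))) ` I \<noteq> {}"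
    using assms(4) by auto
qed

lemma abs_cos_condition_le_1_iff:
  fixes D \<mu> k :: real
  assumes "k\<^sup>2 \<noteq> \<mu>"
  shows "\<bar>D / (\<mu> - k\<^sup>2)\<bar> \<le> 1 \<longleftrightarrow> k\<^sup>2 \<le> \<mu> - \<bar>D\<bar> \<or> k\<^sup>2 \<ge> \<mu> + \<bar>D\<bar>"
proof -
  have "\<bar>D / (\<mu> - k\<^sup>2)\<bar> \<le> 1 \<longleftrightarrow> \<bar>D\<bar> \<le> \<bar>\<mu> - k\<^sup>2\<bar>"
    using assms by (simp add: abs_divide divide_le_eq)
  then show ?thesis
    by linarith
qed

lemma sqrt_power_bounds:
  fixes c k :: real
  assumes "c > 0"
  shows "k\<^sup>2 \<le> c \<longleftrightarrow> k \<in> {- sqrt c..sqrt c}"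
    and "k\<^sup>2 \<ge> c \<and> k > 0 \<longleftrightarrow> k \<in> {sqrt c..}"
    and "k\<^sup>2 \<ge> c \<and> k < 0 \<longleftrightarrow> k \<in> {..- sqrt c}"
proof -
  have s: "sqrt c > 0" "(sqrt c)\<^sup>2 = c"
    using assms by simp_all
  have "k\<^sup>2 \<le> c \<longleftrightarrow> \<bar>k\<bar> \<le> sqrt c" "k\<^sup>2 \<ge> c \<longleftrightarrow> sqrt c \<le> \<bar>k\<bar>"
    using s abs_le_square_iff[of k "sqrt c"] abs_le_square_iff[of "sqrt c" k] by simp_all
  then show "k\<^sup>2 \<le> c \<longleftrightarrow> k \<in> {- sqrt c..sqrt c}"
    "k\<^sup>2 \<ge> c \<and> k > 0 \<longleftrightarrow> k \<in> {sqrt c..}" "k\<^sup>2 \<ge> c \<and> k < 0 \<longleftrightarrow> k \<in> {..- sqrt c}"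
    using s(1) unfolding atLeastAtMost_iff atLeast_iff atMost_iff by linarith+
qed

context
  fixes D \<mu> :: real and f :: "real \<Rightarrow> real"
  defines "f \<equiv> \<lambda>k. D / (\<mu> - k\<^sup>2)"
begin

text \<open>An interval of admissible wavenumbers that contains one with \<open>\<bar>cos \<theta>\<bar> = 1\<close> carries a connected
  set of wavetrain parameters. The condition \<open>D \<noteq> 0\<close> keeps the interval away from the singularities
  \<open>k\<^sup>2 = \<mu>\<close> of \<open>f\<close>.\<close>

lemma wavetrain_angles_component:
  assumes "D \<noteq> 0" "connected I" "k\<^sub>0 \<in> I" "\<bar>\<mu> - k\<^sub>0\<^sup>2\<bar> = \<bar>D\<bar>"
    and I: "\<And>k. k \<in> I \<Longrightarrow> k\<^sup>2 \<le> \<mu> - \<bar>D\<bar> \<or> k\<^sup>2 \<ge> \<mu> + \<bar>D\<bar>"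
  shows "connected (angles_over f I)" "fst ` angles_over f I = I"
proof -
  have ne: "k\<^sup>2 \<noteq> \<mu>" if "k \<in> I" for k
    using I[OF that] assms(1) by linarith
  have le: "\<forall>k\<in>I. \<bar>f k\<bar> \<le> 1"
    unfolding f_def using abs_cos_condition_le_1_iff[OF ne] I by blast
  have "continuous_on I f"
    unfolding f_def by (intro continuous_intros) (use ne in force)
  moreover have "\<bar>f k\<^sub>0\<bar> = 1"
    using assms(1,4) by (simp add: f_def abs_divide)
  ultimately show "connected (angles_over f I)"
    using connected_angles_over[OF assms(2) _ le assms(3)] by blast
  show "fst ` angles_over f I = I"
    by (rule fst_image_angles_over[OF le])
qed

lemma outer_wavetrain_angles:
  assumes "D \<noteq> 0" "\<mu> + \<bar>D\<bar> > 0"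
  defines "b \<equiv> sqrt (\<mu> + \<bar>D\<bar>)"
  shows "connected (angles_over f {b..})" "fst ` angles_over f {b..} = {b..}"
    "connected (angles_over f {..- b})" "fst ` angles_over f {..- b} = {..- b}"
proof -
  have "\<bar>\<mu> - b\<^sup>2\<bar> = \<bar>D\<bar>" "\<bar>\<mu> - (- b)\<^sup>2\<bar> = \<bar>D\<bar>"
    unfolding b_def using assms(2) by simp_all
  moreover have "k\<^sup>2 \<le> \<mu> - \<bar>D\<bar> \<or> k\<^sup>2 \<ge> \<mu> + \<bar>D\<bar>" if "k \<in> {b..} \<or> k \<in> {..- b}" for k
    using that sqrt_power_bounds(2,3)[OF assms(2), of k] unfolding b_def by blast
  ultimately show "connected (angles_over f {b..})" "fst ` angles_over f {b..} = {b..}"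
    "connected (angles_over f {..- b})" "fst ` angles_over f {..- b} = {..- b}"
    using wavetrain_angles_component[OF assms(1), of "{b..}" b]
      wavetrain_angles_component[OF assms(1), of "{..- b}" "- b"] by simp_all
qed

text \<open>Since \<open>\<mu> > 0\<close>, the excluded wavenumbers \<open>\<plusminus>sqrt \<mu>\<close> separate the three intervals and make the
  part of the parameter set over each of them relatively open.\<close>

lemma components_supercritical:
  assumes "D \<noteq> 0" "\<mu> > \<bar>D\<bar>"
  defines "a \<equiv> sqrt (\<mu> - \<bar>D\<bar>)" and "b \<equiv> sqrt (\<mu> + \<bar>D\<bar>)"
  shows "components {(k, z). k\<^sup>2 \<noteq> \<mu> \<and> norm z = 1 \<and> Re z = f k} =
     {angles_over f {- a..a}, angles_over f {b..}, angles_over f {..- b}}" (is "components ?W = _")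
    and "fst ` angles_over f {- a..a} = {- a..a}"
proof -
  have pos: "\<mu> - \<bar>D\<bar> > 0" "\<mu> + \<bar>D\<bar> > 0"
    using assms(2) by linarith+
  have "\<bar>\<mu> - a\<^sup>2\<bar> = \<bar>D\<bar>" "a > 0" "b > 0"
    unfolding a_def b_def using pos by simp_all
  moreover have "k\<^sup>2 \<le> \<mu> - \<bar>D\<bar> \<or> k\<^sup>2 \<ge> \<mu> + \<bar>D\<bar>" if "k \<in> {- a..a}" for k
    using that sqrt_power_bounds(1)[OF pos(1), of k] unfolding a_def by blast
  ultimately have inner: "connected (angles_over f {- a..a})" "fst ` angles_over f {- a..a} = {- a..a}"
    using wavetrain_angles_component[OF assms(1), of "{- a..a}" a] by simp_all
  then show "fst ` angles_over f {- a..a} = {- a..a}"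
    by simp
  note outer = outer_wavetrain_angles[OF assms(1) pos(2), folded b_def]
  have W: "(k, z) \<in> ?W \<Longrightarrow> k\<^sup>2 \<le> \<mu> - \<bar>D\<bar> \<or> k\<^sup>2 \<ge> \<mu> + \<bar>D\<bar>" for k z
    using abs_cos_condition_le_1_iff[of k \<mu> D] abs_Re_le_cmod[of z] unfolding f_def by auto
  have eq: "angles_over f {- a..a} = ?W \<inter> {p. (fst p)\<^sup>2 < \<mu>}"
    "angles_over f {b..} = ?W \<inter> {p. (fst p)\<^sup>2 > \<mu> \<and> fst p > 0}"
    "angles_over f {..- b} = ?W \<inter> {p. (fst p)\<^sup>2 > \<mu> \<and> fst p < 0}"
    unfolding angles_over_def a_def b_def sqrt_power_bounds[OF pos(1), symmetric]
      sqrt_power_bounds[OF pos(2), symmetric]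
    using W assms(1) by fastforce+
  show "components ?W = {angles_over f {- a..a}, angles_over f {b..}, angles_over f {..- b}}"
  proof (rule components_eq_relatively_open_partition)
    have "open {p :: real \<times> complex. (fst p)\<^sup>2 < \<mu>}"
      "open {p :: real \<times> complex. (fst p)\<^sup>2 > \<mu> \<and> fst p > 0}"
      "open {p :: real \<times> complex. (fst p)\<^sup>2 > \<mu> \<and> fst p < 0}"
      by (intro open_Collect_less open_Collect_conj continuous_intros)+
    then have "openin (top_of_set ?W) (angles_over f {- a..a})"
      "openin (top_of_set ?W) (angles_over f {b..})" "openin (top_of_set ?W) (angles_over f {..- b})"
      unfolding eq by (simp_all only: openin_open_Int)
    moreover have "angles_over f {- a..a} \<noteq> {}" "angles_over f {b..} \<noteq> {}" "angles_over f {..- b} \<noteq> {}"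
      using inner(2) outer(2,4) \<open>a > 0\<close> by force+
    ultimately show "openin (top_of_set ?W) A \<and> connected A \<and> A \<noteq> {}"
      if "A \<in> {angles_over f {- a..a}, angles_over f {b..}, angles_over f {..- b}}" for A
      using that inner(1) outer(1,3) by blast
    show "disjoint {angles_over f {- a..a}, angles_over f {b..}, angles_over f {..- b}}"
      unfolding eq disjoint_def by auto
    have "\<mu> > 0"
      using assms(2) by linarith
    then show "\<Union>{angles_over f {- a..a}, angles_over f {b..}, angles_over f {..- b}} = ?W"
      unfolding eq by (auto simp: neq_iff) (metis linorder_neqE_linordered_idom not_less_iff_gr_or_eq power_zero_numeral)
  qed
qed

text \<open>Since \<open>\<mu> - \<bar>D\<bar> < 0\<close>, only the condition \<open>k\<^sup>2 \<ge> \<mu> + \<bar>D\<bar> > 0\<close> remains, and the sign of \<open>k\<close>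
  separates the components.\<close>

lemma components_subcritical:
  assumes "\<bar>\<mu>\<bar> < \<bar>D\<bar>"
  defines "b \<equiv> sqrt (\<mu> + \<bar>D\<bar>)"
  shows "components {(k, z). k\<^sup>2 \<noteq> \<mu> \<and> norm z = 1 \<and> Re z = f k} =
     {angles_over f {b..}, angles_over f {..- b}}" (is "components ?W = _")
proof -
  have D: "D \<noteq> 0" and pos: "\<mu> + \<bar>D\<bar> > 0"
    using assms(1) by linarith+
  note outer = outer_wavetrain_angles[OF D pos, folded b_def]
  have W: "(k, z) \<in> ?W \<Longrightarrow> k\<^sup>2 \<ge> \<mu> + \<bar>D\<bar> \<and> k \<noteq> 0" for k z
  proof -
    assume "(k, z) \<in> ?W"
    then have "k\<^sup>2 \<le> \<mu> - \<bar>D\<bar> \<or> k\<^sup>2 \<ge> \<mu> + \<bar>D\<bar>"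
      using abs_cos_condition_le_1_iff[of k \<mu> D] abs_Re_le_cmod[of z] unfolding f_def by auto
    then have "k\<^sup>2 \<ge> \<mu> + \<bar>D\<bar>"
      using zero_le_power2[of k] assms(1) by linarith
    with pos show "k\<^sup>2 \<ge> \<mu> + \<bar>D\<bar> \<and> k \<noteq> 0"
      by auto
  qed
  have eq: "angles_over f {b..} = ?W \<inter> {p. fst p > 0}"
    "angles_over f {..- b} = ?W \<inter> {p. fst p < 0}"
    unfolding angles_over_def b_def sqrt_power_bounds[OF pos, symmetric]
    using W D by fastforce+
  show ?thesis
  proof (rule components_eq_relatively_open_partition)
    have "open {p :: real \<times> complex. fst p > 0}" "open {p :: real \<times> complex. fst p < 0}"
      by (intro open_Collect_less continuous_intros)+
    then have "openin (top_of_set ?W) (angles_over f {b..})" "openin (top_of_set ?W) (angles_over f {..- b})"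
      unfolding eq by (simp_all only: openin_open_Int)
    moreover have "angles_over f {b..} \<noteq> {}" "angles_over f {..- b} \<noteq> {}"
      using outer(2,4) by force+
    ultimately show "openin (top_of_set ?W) A \<and> connected A \<and> A \<noteq> {}"
      if "A \<in> {angles_over f {b..}, angles_over f {..- b}}" for A
      using that outer(1,3) by blast
    show "disjoint {angles_over f {b..}, angles_over f {..- b}}"
      unfolding eq disjoint_def by auto
    show "\<Union>{angles_over f {b..}, angles_over f {..- b}} = ?W"
      unfolding eq using W by fastforce
  qed
qed

text \<open>Here \<open>\<bar>D\<bar> < \<bar>\<mu> - k\<^sup>2\<bar>\<close> for all \<open>k\<close>, so \<open>sin \<theta>\<close> never vanishes and its sign separates the
  two sheets.\<close>

lemma components_subsubcritical:
  assumes "\<mu> < - \<bar>D\<bar>"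
  defines "C \<equiv> \<lambda>s::real. range (\<lambda>k. (k, cis (s * arccos (f k))))"
  shows "components {(k, z). k\<^sup>2 \<noteq> \<mu> \<and> norm z = 1 \<and> Re z = f k} = {C 1, C (- 1)}"
      (is "components ?W = _")
    and "C 1 \<noteq> C (- 1)" and "graph_over_k_axis (C s)"
proof -
  have less: "\<mu> - k\<^sup>2 < - \<bar>D\<bar>" for k
    using assms(1) zero_le_power2[of k] by linarith
  have ne: "k\<^sup>2 \<noteq> \<mu>" for k
    using less[of k] by auto
  have bound: "\<bar>f k\<bar> < 1" for k
  proof -
    have "\<bar>D\<bar> < \<bar>\<mu> - k\<^sup>2\<bar>"
      using less[of k] by linarith
    then show ?thesis
      unfolding f_def abs_divide by (subst pos_divide_less_eq) auto
  qed
  have cont: "continuous_on UNIV f"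
    unfolding f_def by (intro continuous_intros) (use ne in force)
  show "graph_over_k_axis (C s)" for s
    unfolding graph_over_k_axis_def C_def
    using continuous_on_arccos_comp[OF cont] less_imp_le[OF bound]
    by (intro exI[of _ "\<lambda>k. s * arccos (f k)"]) simp
  have W: "?W = angles_over f UNIV"
    unfolding angles_over_def using ne by simp
  also have "\<dots> = C 1 \<union> C (- 1)"
    unfolding C_def using angles_over_eq_sheets[of UNIV f] less_imp_le[OF bound] by simp
  finally have union: "?W = C 1 \<union> C (- 1)" .
  have "sin (arccos (f k)) > 0" for k
    using bound[of k] sin_arccos_nonzero[of "f k"] sin_ge_zero[OF arccos_lbound arccos_ubound, of "f k"]
    by (simp add: abs_less_iff order_le_less minus_less_iff)
  then have Im: "\<forall>p\<in>C 1. Im (snd p) > 0" "\<forall>p\<in>C (- 1). Im (snd p) < 0"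
    unfolding C_def by (auto simp: image_iff)
  then have eq: "C 1 = ?W \<inter> {p. Im (snd p) > 0}" "C (- 1) = ?W \<inter> {p. Im (snd p) < 0}"
    unfolding union by fastforce+
  have nonempty: "C s \<noteq> {}" for s
    unfolding C_def by simp
  have disj: "C 1 \<inter> C (- 1) = {}"
    using Im by fastforce
  then show "C 1 \<noteq> C (- 1)"
    using nonempty[of 1] by blast
  show "components ?W = {C 1, C (- 1)}"
  proof (rule components_eq_relatively_open_partition)
    have "open {p :: real \<times> complex. Im (snd p) > 0}" "open {p :: real \<times> complex. Im (snd p) < 0}"
      by (intro open_Collect_less continuous_intros)+
    then have "openin (top_of_set ?W) (C 1)" "openin (top_of_set ?W) (C (- 1))"
      unfolding eq by (simp_all only: openin_open_Int)
    moreover have "connected (C s)" for s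
      unfolding C_def using connected_arccos_graph[OF connected_UNIV cont] less_imp_le[OF bound] by simp
    ultimately show "openin (top_of_set ?W) A \<and> connected A \<and> A \<noteq> {}" if "A \<in> {C 1, C (- 1)}" for A
      using that nonempty by blast
    show "disjoint {C 1, C (- 1)}"
      using disj by (auto simp: disjoint_def)
    show "\<Union>{C 1, C (- 1)} = ?W"
      using union by simp
  qed
qed

end

section \<open>Homogeneous wavetrains and their emergence from a pole\<close>

lemma has_partials_homogeneous_wavetrain:
  "has_partials (wavetrain 0 \<omega> \<theta>)
     (\<lambda>x t. vector [- \<omega> * - sin (- \<omega> * t) * sin \<theta>, - \<omega> * cos (- \<omega> * t) * sin \<theta>, 0]) (\<lambda>x t. 0)"
proof -
  have w: "wavetrain 0 \<omega> \<theta> x t =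
     (cos (- \<omega> * t) * sin \<theta>) *\<^sub>R axis 1 1 + (sin (- \<omega> * t) * sin \<theta>) *\<^sub>R axis 2 1 + cos \<theta> *\<^sub>R axis 3 1"
    for x t
    unfolding wavetrain_def by (simp add: vec_eq_iff forall_3 axis_def)
  have d: "vector [- \<omega> * - sin (- \<omega> * t) * sin \<theta>, - \<omega> * cos (- \<omega> * t) * sin \<theta>, 0] =
     (- \<omega> * - sin (- \<omega> * t) * sin \<theta>) *\<^sub>R axis 1 (1::real) + (- \<omega> * cos (- \<omega> * t) * sin \<theta>) *\<^sub>R (axis 2 1 :: real^3)"
    for t
    by (simp add: vec_eq_iff forall_3 axis_def)
  show ?thesis
    unfolding has_partials_def
  proof (intro conjI allI exI[of _ "\<lambda>x t. 0"])
    fix x t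
    show "((\<lambda>s. wavetrain 0 \<omega> \<theta> x s) has_vector_derivative
        vector [- \<omega> * - sin (- \<omega> * t) * sin \<theta>, - \<omega> * cos (- \<omega> * t) * sin \<theta>, 0]) (at t)"
      unfolding w d
      by (rule derivative_eq_intros refl | simp add: mult_ac)+
    show "((\<lambda>y. wavetrain 0 \<omega> \<theta> y t) has_vector_derivative 0) (at x)"
      unfolding w by simp
    show "((\<lambda>y. 0) has_vector_derivative (0 :: real^3)) (at x)"
      by simp
  qed
qed

lemma norm_wavetrain: "norm (wavetrain k \<omega> \<theta> x t) = 1"
proof -
  define c s where "c = cos (k * x - \<omega> * t)" and "s = sin (k * x - \<omega> * t)"
  have "(norm (wavetrain k \<omega> \<theta> x t))\<^sup>2 = (sin \<theta>)\<^sup>2 * (c\<^sup>2 + s\<^sup>2) + (cos \<theta>)\<^sup>2"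
    unfolding power2_norm_eq_inner wavetrain_def inner_vec_def sum_3 c_def[symmetric] s_def[symmetric]
    by (simp add: power2_eq_square algebra_simps)
  also have "\<dots> = 1"
    by (simp add: c_def s_def)
  finally have "(norm (wavetrain k \<omega> \<theta> x t))\<^sup>2 = 1\<^sup>2"
    by simp
  then show ?thesis
    by (rule power2_eq_imp_eq) simp_all
qed

text \<open>For \<open>\<^bold>m = wavetrain 0 \<omega> \<theta>\<close> the residual of the equation is a combination of \<open>\<^bold>m \<times> e\<^sub>3\<close> and
  \<open>\<^bold>m \<times> (\<^bold>m \<times> e\<^sub>3)\<close> with the constant coefficients \<open>\<omega> - (\<mu> cos \<theta> - h)\<close> and
  \<open>- (\<alpha> \<omega> + \<beta>)\<close>. These two vectors are linearly independent for \<open>sin \<theta> \<noteq> 0\<close>, so both coefficients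
  have to vanish.\<close>

lemma llgs_solution_homogeneous_wavetrain_iff:
  assumes "\<alpha> \<noteq> 0" "sin \<theta> \<noteq> 0"
  shows "llgs_solution \<alpha> \<beta> h \<mu> (wavetrain 0 \<omega> \<theta>) \<longleftrightarrow>
     \<omega> = - \<beta> / \<alpha> \<and> \<mu> * cos \<theta> = h - \<beta> / \<alpha>"
proof -
  define wt where "wt t = (vector [- \<omega> * - sin (- \<omega> * t) * sin \<theta>, - \<omega> * cos (- \<omega> * t) * sin \<theta>, 0] :: real^3)" for t
  have "llgs_solution \<alpha> \<beta> h \<mu> (wavetrain 0 \<omega> \<theta>) \<longleftrightarrow>
      (\<forall>x t. wt t = llgs_rhs \<alpha> \<beta> h \<mu> (wavetrain 0 \<omega> \<theta> x t) (wt t) 0)"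
    (is "_ \<longleftrightarrow> ?R")
  proof
    assume "llgs_solution \<alpha> \<beta> h \<mu> (wavetrain 0 \<omega> \<theta>)"
    then obtain mt mxx where m: "has_partials (wavetrain 0 \<omega> \<theta>) mt mxx"
      and eqn: "\<And>x t. mt x t = llgs_rhs \<alpha> \<beta> h \<mu> (wavetrain 0 \<omega> \<theta> x t) (mt x t) (mxx x t)"
      unfolding llgs_solution_def by blast
    show ?R
      using eqn unfolding has_partials_unique[OF m has_partials_homogeneous_wavetrain] wt_def[symmetric]
      by blast
  next
    assume ?R
    then show "llgs_solution \<alpha> \<beta> h \<mu> (wavetrain 0 \<omega> \<theta>)"
      unfolding llgs_solution_def
      using norm_wavetrain has_partials_homogeneous_wavetrain[of \<omega> \<theta>, folded wt_def]
      by (intro conjI allI exI[of _ "\<lambda>x t. wt t"] exI[of _ "\<lambda>x t. 0"]) simp_all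
  qed
  also have "\<dots> \<longleftrightarrow> \<alpha> * \<omega> + \<beta> = 0 \<and> \<omega> = \<mu> * cos \<theta> - h"
  proof -
    have diff: "wt t - llgs_rhs \<alpha> \<beta> h \<mu> (wavetrain 0 \<omega> \<theta> x t) (wt t) 0 =
        (\<omega> - (\<mu> * cos \<theta> - h)) *\<^sub>R cross3 (wavetrain 0 \<omega> \<theta> x t) e3
        - (\<alpha> * \<omega> + \<beta>) *\<^sub>R cross3 (wavetrain 0 \<omega> \<theta> x t) (cross3 (wavetrain 0 \<omega> \<theta> x t) e3)" for x t
      unfolding wt_def llgs_rhs_def wavetrain_def
      by (simp add: vec_eq_iff forall_3 cross3_def axis_def) (simp add: algebra_simps)
    show ?thesis
    proof
      assume "\<forall>x t. wt t = llgs_rhs \<alpha> \<beta> h \<mu> (wavetrain 0 \<omega> \<theta> x t) (wt t) 0"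
      then have "(\<omega> - (\<mu> * cos \<theta> - h)) *\<^sub>R cross3 (wavetrain 0 \<omega> \<theta> 0 0) e3
        - (\<alpha> * \<omega> + \<beta>) *\<^sub>R cross3 (wavetrain 0 \<omega> \<theta> 0 0) (cross3 (wavetrain 0 \<omega> \<theta> 0 0) e3) = 0"
        unfolding diff[symmetric] by simp
      then have "(\<omega> - (\<mu> * cos \<theta> - h)) * sin \<theta> = 0" "(\<alpha> * \<omega> + \<beta>) * sin \<theta> * sin \<theta> = 0"
        unfolding wavetrain_def by (simp_all add: vec_eq_iff forall_3 cross3_def axis_def)
      then show "\<alpha> * \<omega> + \<beta> = 0 \<and> \<omega> = \<mu> * cos \<theta> - h"
        using assms(2) by simp
    next
      assume "\<alpha> * \<omega> + \<beta> = 0 \<and> \<omega> = \<mu> * cos \<theta> - h"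
      then have zero: "\<omega> - (\<mu> * cos \<theta> - h) = 0" "\<alpha> * \<omega> + \<beta> = 0"
        by linarith+
      then have "wt t - llgs_rhs \<alpha> \<beta> h \<mu> (wavetrain 0 \<omega> \<theta> x t) (wt t) 0 = 0" for x t
        unfolding diff zero by simp
      then show "\<forall>x t. wt t = llgs_rhs \<alpha> \<beta> h \<mu> (wavetrain 0 \<omega> \<theta> x t) (wt t) 0"
        by simp
    qed
  qed
  also have "\<dots> \<longleftrightarrow> \<omega> = - \<beta> / \<alpha> \<and> \<mu> * cos \<theta> = h - \<beta> / \<alpha>"
  proof -
    have "\<alpha> * \<omega> + \<beta> = 0 \<longleftrightarrow> \<omega> = - \<beta> / \<alpha>"
      using assms(1) by (auto simp: field_simps add_eq_0_iff2)
    then show ?thesis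
      by auto
  qed
  finally show ?thesis .
qed

text \<open>The distance does not depend on \<open>x\<close> and \<open>t\<close>, which makes convergence to the pole uniform as soon
  as \<open>cos \<theta>\<close> converges.\<close>

lemma dist_wavetrain_pole:
  assumes "\<epsilon>\<^sup>2 = 1"
  shows "dist (wavetrain k \<omega> \<theta> x t) (\<epsilon> *\<^sub>R e3) = sqrt (2 * (1 - \<epsilon> * cos \<theta>))"
proof -
  have "(dist (wavetrain k \<omega> \<theta> x t) (\<epsilon> *\<^sub>R e3))\<^sup>2 =
      (norm (wavetrain k \<omega> \<theta> x t))\<^sup>2 + \<epsilon>\<^sup>2 - 2 * (\<epsilon> * (wavetrain k \<omega> \<theta> x t $ 3))"
    unfolding dist_norm power2_norm_eq_inner
    by (simp add: inner_diff inner_axis inner_axis' power2_eq_square algebra_simps)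
  also have "\<dots> = 2 * (1 - \<epsilon> * cos \<theta>)"
    unfolding norm_wavetrain assms by (simp add: wavetrain_def)
  finally show ?thesis
    by (metis real_sqrt_unique zero_le_dist)
qed

text \<open>The existence condition \<open>\<mu> cos \<theta> = D\<close> with \<open>\<bar>cos \<theta>\<bar> < 1\<close> is \<open>\<bar>\<mu>\<bar> > \<bar>D\<bar>\<close>. It does not refer to
  the direction in which \<open>\<mu>\<close> moves, so one argument serves the thresholds \<open>\<bar>D\<bar>\<close> and \<open>- \<bar>D\<bar>\<close>.\<close>

lemma solutions_emerge_at_pole:
  assumes "\<alpha> > 0" "\<epsilon>\<^sup>2 = 1" "\<mu>\<^sub>c = \<epsilon> * (h - \<beta> / \<alpha>)" "h \<noteq> \<beta> / \<alpha>"
    and after: "\<forall>\<^sub>F \<mu> in G. \<bar>\<mu>\<bar> > \<bar>h - \<beta> / \<alpha>\<bar>"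
    and before: "\<forall>\<^sub>F \<mu> in F. \<bar>\<mu>\<bar> < \<bar>h - \<beta> / \<alpha>\<bar>"
    and G: "G \<le> nhds \<mu>\<^sub>c"
  shows "solutions_emerge \<alpha> \<beta> h (\<epsilon> *\<^sub>R e3) \<mu>\<^sub>c F G"
proof -
  define D where "D = h - \<beta> / \<alpha>"
  have D: "D \<noteq> 0" "\<mu>\<^sub>c = \<epsilon> * D"
    using assms(3,4) unfolding D_def by simp_all
  have e: "\<bar>\<epsilon>\<bar> = 1" "\<epsilon> * \<epsilon> = 1"
    using assms(2) by (auto simp: power2_eq_1_iff)
  note solution = llgs_solution_homogeneous_wavetrain_iff[where \<alpha> = \<alpha> and h = h and \<beta> = \<beta>, folded D_def]
  \<comment> \<open>\<open>sin \<theta> \<noteq> 0\<close> forces \<open>\<bar>cos \<theta>\<bar> < 1\<close>, so \<open>\<mu> cos \<theta> = D\<close> needs \<open>\<bar>\<mu>\<bar> > \<bar>D\<bar>\<close>.\<close>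
  have none: "\<not> llgs_solution \<alpha> \<beta> h \<mu> (wavetrain 0 \<omega> \<theta>)" if "\<bar>\<mu>\<bar> \<le> \<bar>D\<bar>" "sin \<theta> \<noteq> 0" for \<mu> \<omega> \<theta>
  proof
    assume "llgs_solution \<alpha> \<beta> h \<mu> (wavetrain 0 \<omega> \<theta>)"
    then have "\<mu> * cos \<theta> = D"
      using solution[of \<theta>] that(2) assms(1) by simp
    moreover have "\<bar>cos \<theta>\<bar> < 1"
      using that(2) sin_cos_squared_add[of \<theta>] abs_square_less_1[of "cos \<theta>"]
      by (metis add.commute less_add_same_cancel1 zero_less_power2)
    then have "\<bar>D\<bar> * \<bar>cos \<theta>\<bar> < \<bar>D\<bar>"
      using D(1) by simp
    moreover have "\<bar>\<mu> * cos \<theta>\<bar> \<le> \<bar>D\<bar> * \<bar>cos \<theta>\<bar>"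
      unfolding abs_mult using that(1) by (intro mult_right_mono) auto
    ultimately show False
      by simp
  qed
  \<comment> \<open>After the transition the condition \<open>\<mu> cos \<theta> = D\<close> is solved by the following angle.\<close>
  define \<theta> where "\<theta> \<mu> = arccos (D / \<mu>)" for \<mu>
  have \<theta>: "cos (\<theta> \<mu>) = D / \<mu> \<and> sin (\<theta> \<mu>) \<noteq> 0 \<and> \<mu> \<noteq> 0" if "\<bar>\<mu>\<bar> > \<bar>D\<bar>" for \<mu>
  proof -
    have "\<bar>D / \<mu>\<bar> < 1"
      using that by (simp add: abs_divide divide_less_eq)
    then have "- 1 < D / \<mu>" "D / \<mu> < 1"
      by linarith+
    then show ?thesis
      unfolding \<theta>_def using that sin_arccos_nonzero[of "D / \<mu>"] by (intro conjI cos_arccos) auto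
  qed
  have exist: "\<forall>\<^sub>F \<mu> in G. sin (\<theta> \<mu>) \<noteq> 0 \<and> llgs_solution \<alpha> \<beta> h \<mu> (wavetrain 0 (- \<beta> / \<alpha>) (\<theta> \<mu>))"
    using after unfolding D_def[symmetric]
  proof eventually_elim
    case (elim \<mu>)
    then show ?case
      using \<theta>[of \<mu>] solution[of "\<theta> \<mu>"] assms(1) by simp
  qed
  have lim: "uniform_limit UNIV (\<lambda>\<mu> (x, t). wavetrain 0 (- \<beta> / \<alpha>) (\<theta> \<mu>) x t) (\<lambda>_. \<epsilon> *\<^sub>R e3) G"
  proof (rule uniform_limitI)
    fix r :: real
    assume "r > 0"
    have "((\<lambda>\<mu>. sqrt (2 * (1 - \<epsilon> * (D / \<mu>)))) \<longlongrightarrow> sqrt (2 * (1 - \<epsilon> * (D / \<mu>\<^sub>c)))) G"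
      using D e(1) G filterlim_ident[of G]
      by (intro tendsto_intros) (auto simp: filterlim_def)
    moreover have "\<epsilon> * (D / \<mu>\<^sub>c) = 1"
      using D e by (simp add: field_simps)
    then have "sqrt (2 * (1 - \<epsilon> * (D / \<mu>\<^sub>c))) = 0"
      by (simp only:) simp
    ultimately have "((\<lambda>\<mu>. sqrt (2 * (1 - \<epsilon> * (D / \<mu>)))) \<longlongrightarrow> 0) G"
      by (simp only:)
    then have "\<forall>\<^sub>F \<mu> in G. sqrt (2 * (1 - \<epsilon> * (D / \<mu>))) < r"
      using \<open>r > 0\<close> order_tendstoD(2) by blast
    with after show "\<forall>\<^sub>F \<mu> in G. \<forall>p\<in>UNIV.
        dist (case p of (x, t) \<Rightarrow> wavetrain 0 (- \<beta> / \<alpha>) (\<theta> \<mu>) x t) (\<epsilon> *\<^sub>R e3) < r"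
      unfolding D_def[symmetric]
    proof eventually_elim
      case (elim \<mu>)
      then show ?case
        using \<theta>[of \<mu>] by (auto simp: dist_wavetrain_pole[OF assms(2)])
    qed
  qed
  have "\<bar>\<mu>\<^sub>c\<bar> = \<bar>D\<bar>"
    using D(2) e(1) by (simp add: abs_mult)
  then have "\<forall>\<omega> \<theta>. sin \<theta> \<noteq> 0 \<longrightarrow> \<not> llgs_solution \<alpha> \<beta> h \<mu>\<^sub>c (wavetrain 0 \<omega> \<theta>)"
    using none by simp
  moreover have "\<forall>\<^sub>F \<mu> in F. \<forall>\<omega> \<theta>. sin \<theta> \<noteq> 0 \<longrightarrow> \<not> llgs_solution \<alpha> \<beta> h \<mu> (wavetrain 0 \<omega> \<theta>)"
    using before unfolding D_def[symmetric] by eventually_elim (use none in auto)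
  ultimately show ?thesis
    unfolding solutions_emerge_def using exist lim by (intro conjI exI[of _ "\<lambda>_. - \<beta> / \<alpha>"] exI[of _ \<theta>])
qed

section \<open>Transitions between the regimes\<close>

text \<open>A transition whose first property confines \<open>\<mu>\<close> below \<open>d\<close> and whose second one confines it above
  can only happen at \<open>d\<close> and with \<open>\<mu>\<close> increasing. Downward transitions are reduced to this by
  \<open>transition_reverse\<close>.\<close>

lemma transition_upward:
  assumes "transition P Q \<mu>\<^sub>c F G" "\<And>\<mu>. P \<mu> \<Longrightarrow> \<mu> < d" "\<And>\<mu>. Q \<mu> \<Longrightarrow> \<mu> > d"
  shows "\<mu>\<^sub>c = d \<and> F = at_left \<mu>\<^sub>c \<and> G = at_right \<mu>\<^sub>c"
proof -
  have F: "\<forall>\<^sub>F \<mu> in F. \<mu> < d" and G: "\<forall>\<^sub>F \<mu> in G. d < \<mu>"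
    using assms unfolding transition_def by (auto elim: eventually_mono)
  from assms(1) consider "F = at_left \<mu>\<^sub>c" "G = at_right \<mu>\<^sub>c" | "F = at_right \<mu>\<^sub>c" "G = at_left \<mu>\<^sub>c"
    unfolding transition_def by blast
  then show ?thesis
  proof cases
    case 1
    have "\<mu>\<^sub>c \<le> d"
      using F unfolding 1 eventually_at_left_field by (meson dense leI less_trans not_less_iff_gr_or_eq)
    moreover have "d \<le> \<mu>\<^sub>c"
      using G unfolding 1 eventually_at_right_field by (meson dense leI less_trans not_less_iff_gr_or_eq)
    ultimately show ?thesis
      using 1 by simp
  next
    case 2
    have "\<mu>\<^sub>c < d"
      using F unfolding 2 eventually_at_right_field by (meson dense less_trans)
    moreover have "d < \<mu>\<^sub>c"
      using G unfolding 2 eventually_at_left_field by (meson dense less_trans)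
    ultimately show ?thesis
      by simp
  qed
qed

lemma transition_reverse: "transition P Q \<mu>\<^sub>c F G \<Longrightarrow> transition Q P \<mu>\<^sub>c G F"
  unfolding transition_def by blast

lemma transition_through_interval:
  assumes "l < \<mu>\<^sub>c" "\<mu>\<^sub>c < u" "\<And>\<mu>. l < \<mu> \<Longrightarrow> \<mu> < \<mu>\<^sub>c \<Longrightarrow> P \<mu>" "\<And>\<mu>. \<mu>\<^sub>c < \<mu> \<Longrightarrow> \<mu> < u \<Longrightarrow> Q \<mu>"
  shows "transition P Q \<mu>\<^sub>c (at_left \<mu>\<^sub>c) (at_right \<mu>\<^sub>c)"
  unfolding transition_def
  using assms eventually_at_left_real[OF assms(1)] eventually_at_right_real[OF assms(2)]
  by (auto elim: eventually_mono)

lemma not_bounded_half_line: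
  fixes b :: real
  shows "\<not> bounded {b..}" "\<not> bounded {..b}"
proof -
  have "\<bar>max b (\<bar>a\<bar> + 1)\<bar> > a" "\<bar>min b (- \<bar>a\<bar> - 1)\<bar> > a" for a
    by linarith+
  then show "\<not> bounded {b..}" "\<not> bounded {..b}"
    unfolding bounded_real by (metis atLeast_iff atMost_iff max.cobounded1 min.cobounded1 not_le)+
qed

text \<open>In either direction, an exchange of stability of \<open>\<epsilon> e\<^sub>3\<close> locates the threshold; this identifies
  which of the two poles bifurcates.\<close>

lemma exchange_of_stability_at_pole:
  assumes "\<alpha> > 0" "\<epsilon>\<^sup>2 = 1"
    and "loses_stability \<alpha> \<beta> h (\<epsilon> *\<^sub>R e3) \<mu>\<^sub>c F G \<or> gains_stability \<alpha> \<beta> h (\<epsilon> *\<^sub>R e3) \<mu>\<^sub>c F G"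
  shows "\<mu>\<^sub>c = \<epsilon> * (h - \<beta> / \<alpha>)"
proof -
  obtain F' G' where "transition (\<lambda>\<mu>. strictly_stable \<alpha> \<beta> h \<mu> (\<epsilon> *\<^sub>R e3))
      (\<lambda>\<mu>. unstable \<alpha> \<beta> h \<mu> (\<epsilon> *\<^sub>R e3)) \<mu>\<^sub>c F' G'"
    using assms(3) transition_reverse unfolding loses_stability_def gains_stability_def by blast
  then show ?thesis
    unfolding strictly_stable_iff[OF assms(1,2)] unstable_iff[OF assms(1,2)]
    using transition_upward by blast
qed

lemma transition_sub_to_supercritical_iff:
  assumes "\<alpha> > 0"
  shows "transition (subcritical \<alpha> \<beta> h) (supercritical \<alpha> \<beta> h) \<mu>\<^sub>c F G \<longleftrightarrow>
     h \<noteq> \<beta> / \<alpha> \<and> \<mu>\<^sub>c = \<bar>h - \<beta> / \<alpha>\<bar> \<and> F = at_left \<mu>\<^sub>c \<and> G = at_right \<mu>\<^sub>c"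
    (is "?T \<longleftrightarrow> ?R")
proof
  assume T: ?T
  have "\<mu>\<^sub>c = \<bar>h - \<beta> / \<alpha>\<bar> \<and> F = at_left \<mu>\<^sub>c \<and> G = at_right \<mu>\<^sub>c"
    by (rule transition_upward[OF T]) (auto simp: regime_iff[OF assms])
  moreover have "h \<noteq> \<beta> / \<alpha>"
    using T unfolding transition_def regime_iff[OF assms] by auto
  ultimately show ?R
    by blast
next
  assume R: ?R
  have "transition (subcritical \<alpha> \<beta> h) (supercritical \<alpha> \<beta> h) \<mu>\<^sub>c (at_left \<mu>\<^sub>c) (at_right \<mu>\<^sub>c)"
    by (rule transition_through_interval[of 0 _ "\<mu>\<^sub>c + 1"]) (use R in \<open>auto simp: regime_iff[OF assms]\<close>)
  then show ?T
    using R by blast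
qed

lemma transition_sub_to_subsubcritical_iff:
  assumes "\<alpha> > 0"
  shows "transition (subcritical \<alpha> \<beta> h) (subsubcritical \<alpha> \<beta> h) \<mu>\<^sub>c F G \<longleftrightarrow>
     h \<noteq> \<beta> / \<alpha> \<and> \<mu>\<^sub>c = - \<bar>h - \<beta> / \<alpha>\<bar> \<and> F = at_right \<mu>\<^sub>c \<and> G = at_left \<mu>\<^sub>c"
    (is "?T \<longleftrightarrow> ?R")
proof
  assume T: ?T
  have "\<mu>\<^sub>c = - \<bar>h - \<beta> / \<alpha>\<bar> \<and> G = at_left \<mu>\<^sub>c \<and> F = at_right \<mu>\<^sub>c"
    by (rule transition_upward[OF transition_reverse[OF T]]) (auto simp: regime_iff[OF assms])
  moreover have "h \<noteq> \<beta> / \<alpha>"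
    using T unfolding transition_def regime_iff[OF assms] by auto
  ultimately show ?R
    by blast
next
  assume R: ?R
  have "transition (subsubcritical \<alpha> \<beta> h) (subcritical \<alpha> \<beta> h) \<mu>\<^sub>c (at_left \<mu>\<^sub>c) (at_right \<mu>\<^sub>c)"
    by (rule transition_through_interval[of "\<mu>\<^sub>c - 1" _ 0]) (use R in \<open>auto simp: regime_iff[OF assms]\<close>)
  then show ?T
    using R transition_reverse by blast
qed

lemma supercritical_bifurcation_at_pole:
  assumes "\<alpha> > 0" "\<epsilon>\<^sup>2 = 1" "\<mu>\<^sub>c = \<epsilon> * (h - \<beta> / \<alpha>)"
    and T: "transition (subcritical \<alpha> \<beta> h) (supercritical \<alpha> \<beta> h) \<mu>\<^sub>c F G"
  shows "supercritical_bifurcation \<alpha> \<beta> h (\<epsilon> *\<^sub>R e3) \<mu>\<^sub>c F G"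
proof -
  have FG: "h \<noteq> \<beta> / \<alpha>" "F = at_left \<mu>\<^sub>c" "G = at_right \<mu>\<^sub>c"
    using T unfolding transition_sub_to_supercritical_iff[OF assms(1)] by blast+
  have "loses_stability \<alpha> \<beta> h (\<epsilon> *\<^sub>R e3) \<mu>\<^sub>c F G"
    unfolding loses_stability_def strictly_stable_iff[OF assms(1,2)] unstable_iff[OF assms(1,2)]
      assms(3)[symmetric] FG(2,3)
    by (rule transition_through_interval[of "\<mu>\<^sub>c - 1" _ "\<mu>\<^sub>c + 1"]) auto
  moreover have "\<forall>\<^sub>F \<mu> in F. \<bar>\<mu>\<bar> < \<bar>h - \<beta> / \<alpha>\<bar>" "\<forall>\<^sub>F \<mu> in G. \<bar>\<mu>\<bar> > \<bar>h - \<beta> / \<alpha>\<bar>"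
    using T unfolding transition_def regime_iff[OF assms(1)] by (auto elim!: eventually_mono)
  then have "solutions_emerge \<alpha> \<beta> h (\<epsilon> *\<^sub>R e3) \<mu>\<^sub>c F G"
    using assms(1-3) FG(1) by (intro solutions_emerge_at_pole) (auto simp: FG(3) at_within_def)
  ultimately show ?thesis
    unfolding supercritical_bifurcation_def by blast
qed

lemma subcritical_bifurcation_at_pole:
  assumes "\<alpha> > 0" "\<epsilon>\<^sup>2 = 1" "\<mu>\<^sub>c = \<epsilon> * (h - \<beta> / \<alpha>)"
    and T: "transition (subcritical \<alpha> \<beta> h) (subsubcritical \<alpha> \<beta> h) \<mu>\<^sub>c F G"
  shows "subcritical_bifurcation \<alpha> \<beta> h (\<epsilon> *\<^sub>R e3) \<mu>\<^sub>c F G"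
proof -
  have FG: "h \<noteq> \<beta> / \<alpha>" "F = at_right \<mu>\<^sub>c" "G = at_left \<mu>\<^sub>c"
    using T unfolding transition_sub_to_subsubcritical_iff[OF assms(1)] by blast+
  have "gains_stability \<alpha> \<beta> h (\<epsilon> *\<^sub>R e3) \<mu>\<^sub>c F G"
    unfolding gains_stability_def strictly_stable_iff[OF assms(1,2)] unstable_iff[OF assms(1,2)]
      assms(3)[symmetric] FG(2,3)
    by (rule transition_reverse, rule transition_through_interval[of "\<mu>\<^sub>c - 1" _ "\<mu>\<^sub>c + 1"]) auto
  moreover have "\<forall>\<^sub>F \<mu> in F. \<bar>\<mu>\<bar> < \<bar>h - \<beta> / \<alpha>\<bar>" "\<forall>\<^sub>F \<mu> in G. \<bar>\<mu>\<bar> > \<bar>h - \<beta> / \<alpha>\<bar>"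
    using T unfolding transition_def regime_iff[OF assms(1)] by (auto elim!: eventually_mono)
  then have "solutions_emerge \<alpha> \<beta> h (\<epsilon> *\<^sub>R e3) \<mu>\<^sub>c F G"
    using assms(1-3) FG(1) by (intro solutions_emerge_at_pole) (auto simp: FG(3) at_within_def)
  ultimately show ?thesis
    unfolding subcritical_bifurcation_def by blast
qed

section \<open>Wavetrain parameters and bifurcations in the three regimes\<close>

theorem theorem2:
  fixes \<alpha> \<beta> h :: real
  assumes "\<alpha> > 0"
  shows
    "(\<forall>\<mu>. supercritical \<alpha> \<beta> h \<mu> \<and> h \<noteq> \<beta> / \<alpha> \<longrightarrow>
        (\<exists>C\<^sub>0 C\<^sub>1 C\<^sub>2. components (wavetrain_parameters \<alpha> \<beta> h \<mu>) = {C\<^sub>0, C\<^sub>1, C\<^sub>2} \<and>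
           C\<^sub>0 \<noteq> C\<^sub>1 \<and> C\<^sub>0 \<noteq> C\<^sub>2 \<and> C\<^sub>1 \<noteq> C\<^sub>2 \<and>
           0 \<in> fst ` C\<^sub>0 \<and> bounded (fst ` C\<^sub>0) \<and>
           \<not> bounded (fst ` C\<^sub>1) \<and> (\<forall>k\<in>fst ` C\<^sub>1. k > 0) \<and>
           \<not> bounded (fst ` C\<^sub>2) \<and> (\<forall>k\<in>fst ` C\<^sub>2. k < 0))) \<and>
     (\<forall>\<mu>. subcritical \<alpha> \<beta> h \<mu> \<longrightarrow>
        (\<exists>C\<^sub>1 C\<^sub>2. components (wavetrain_parameters \<alpha> \<beta> h \<mu>) = {C\<^sub>1, C\<^sub>2} \<and> C\<^sub>1 \<noteq> C\<^sub>2 \<and>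
           \<not> bounded (fst ` C\<^sub>1) \<and> (\<forall>k\<in>fst ` C\<^sub>1. k > 0) \<and>
           \<not> bounded (fst ` C\<^sub>2) \<and> (\<forall>k\<in>fst ` C\<^sub>2. k < 0))) \<and>
     (\<forall>\<mu>. subsubcritical \<alpha> \<beta> h \<mu> \<longrightarrow>
        (\<exists>C\<^sub>1 C\<^sub>2. components (wavetrain_parameters \<alpha> \<beta> h \<mu>) = {C\<^sub>1, C\<^sub>2} \<and> C\<^sub>1 \<noteq> C\<^sub>2 \<and>
           graph_over_k_axis C\<^sub>1 \<and> graph_over_k_axis C\<^sub>2)) \<and>
     (\<forall>\<mu>\<^sub>c F G b.
        transition (subcritical \<alpha> \<beta> h) (supercritical \<alpha> \<beta> h) \<mu>\<^sub>c F G \<and> b \<in> {e3, - e3} \<and>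
        (loses_stability \<alpha> \<beta> h b \<mu>\<^sub>c F G \<or> gains_stability \<alpha> \<beta> h b \<mu>\<^sub>c F G) \<longrightarrow>
        (\<beta> \<noteq> 0 \<longrightarrow> hopf_threshold \<alpha> \<beta> h \<mu>\<^sub>c b) \<and>
        supercritical_bifurcation \<alpha> \<beta> h b \<mu>\<^sub>c F G) \<and>
     (\<forall>\<mu>\<^sub>c F G b.
        transition (subcritical \<alpha> \<beta> h) (subsubcritical \<alpha> \<beta> h) \<mu>\<^sub>c F G \<and> b \<in> {e3, - e3} \<and>
        (loses_stability \<alpha> \<beta> h b \<mu>\<^sub>c F G \<or> gains_stability \<alpha> \<beta> h b \<mu>\<^sub>c F G) \<longrightarrow>
        (\<beta> \<noteq> 0 \<longrightarrow> hopf_threshold \<alpha> \<beta> h \<mu>\<^sub>c b) \<and>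
        subcritical_bifurcation \<alpha> \<beta> h b \<mu>\<^sub>c F G) \<and>
     (h \<noteq> \<beta> / \<alpha> \<longrightarrow>
        (\<exists>\<mu>\<^sub>c F G. \<exists>b\<in>{e3, - e3}.
           transition (subcritical \<alpha> \<beta> h) (supercritical \<alpha> \<beta> h) \<mu>\<^sub>c F G \<and>
           supercritical_bifurcation \<alpha> \<beta> h b \<mu>\<^sub>c F G) \<and>
        (\<exists>\<mu>\<^sub>c F G. \<exists>b\<in>{e3, - e3}.
           transition (subcritical \<alpha> \<beta> h) (subsubcritical \<alpha> \<beta> h) \<mu>\<^sub>c F G \<and>
           subcritical_bifurcation \<alpha> \<beta> h b \<mu>\<^sub>c F G))"
proof (intro conjI allI impI)
  have pole: "\<exists>\<epsilon>::real. \<epsilon>\<^sup>2 = 1 \<and> b = \<epsilon> *\<^sub>R e3" if "b \<in> {e3, - e3}" for b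
    using that by (auto intro: exI[of _ 1] exI[of _ "- 1"])
  have pole': "(\<epsilon>::real) *\<^sub>R e3 \<in> {e3, - e3}" if "\<epsilon>\<^sup>2 = 1" for \<epsilon>
    using that by (auto simp: power2_eq_1_iff)

  fix \<mu>
  show "\<exists>C\<^sub>0 C\<^sub>1 C\<^sub>2. components (wavetrain_parameters \<alpha> \<beta> h \<mu>) = {C\<^sub>0, C\<^sub>1, C\<^sub>2} \<and>
           C\<^sub>0 \<noteq> C\<^sub>1 \<and> C\<^sub>0 \<noteq> C\<^sub>2 \<and> C\<^sub>1 \<noteq> C\<^sub>2 \<and>
           0 \<in> fst ` C\<^sub>0 \<and> bounded (fst ` C\<^sub>0) \<and>
           \<not> bounded (fst ` C\<^sub>1) \<and> (\<forall>k\<in>fst ` C\<^sub>1. k > 0) \<and>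
           \<not> bounded (fst ` C\<^sub>2) \<and> (\<forall>k\<in>fst ` C\<^sub>2. k < 0)"
    if "supercritical \<alpha> \<beta> h \<mu> \<and> h \<noteq> \<beta> / \<alpha>"
  proof -
    define D where "D = h - \<beta> / \<alpha>"
    define a b where "a = sqrt (\<mu> - \<bar>D\<bar>)" and "b = sqrt (\<mu> + \<bar>D\<bar>)"
    define C where "C = angles_over (\<lambda>k. D / (\<mu> - k\<^sup>2))"
    have D: "D \<noteq> 0" "\<mu> > \<bar>D\<bar>"
      using that unfolding D_def regime_iff[OF assms] by simp_all
    have ab: "a > 0" "b > 0"
      unfolding a_def b_def using D(2) by simp_all
    have fst: "fst ` C {- a..a} = {- a..a}" "fst ` C {b..} = {b..}" "fst ` C {..- b} = {..- b}"
      unfolding C_def a_def b_def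
      using components_supercritical(2)[OF D] outer_wavetrain_angles(2,4)[OF D(1), of \<mu>] D(2) by simp_all
    have "components (wavetrain_parameters \<alpha> \<beta> h \<mu>) = {C {- a..a}, C {b..}, C {..- b}}"
      unfolding wavetrain_parameters_eq D_def[symmetric] C_def a_def b_def
      by (rule components_supercritical(1)[OF D])
    moreover have "0 \<in> {- a..a}" "0 \<notin> {b..}" "0 \<notin> {..- b}" "b \<in> {b..}" "b \<notin> {..- b}"
      using ab by simp_all
    then have "C {- a..a} \<noteq> C {b..}" "C {- a..a} \<noteq> C {..- b}" "C {b..} \<noteq> C {..- b}"
      using fst by metis+
    moreover have "0 \<in> fst ` C {- a..a}" "bounded (fst ` C {- a..a})"
      "\<not> bounded (fst ` C {b..})" "\<forall>k\<in>fst ` C {b..}. k > 0"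
      "\<not> bounded (fst ` C {..- b})" "\<forall>k\<in>fst ` C {..- b}. k < 0"
      unfolding fst using ab not_bounded_half_line by auto
    ultimately show ?thesis
      by blast
  qed
  show "\<exists>C\<^sub>1 C\<^sub>2. components (wavetrain_parameters \<alpha> \<beta> h \<mu>) = {C\<^sub>1, C\<^sub>2} \<and> C\<^sub>1 \<noteq> C\<^sub>2 \<and>
           \<not> bounded (fst ` C\<^sub>1) \<and> (\<forall>k\<in>fst ` C\<^sub>1. k > 0) \<and>
           \<not> bounded (fst ` C\<^sub>2) \<and> (\<forall>k\<in>fst ` C\<^sub>2. k < 0)"
    if "subcritical \<alpha> \<beta> h \<mu>"
  proof -
    define D where "D = h - \<beta> / \<alpha>"
    define b where "b = sqrt (\<mu> + \<bar>D\<bar>)"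
    define C where "C = angles_over (\<lambda>k. D / (\<mu> - k\<^sup>2))"
    have D: "\<bar>\<mu>\<bar> < \<bar>D\<bar>"
      using that unfolding D_def regime_iff[OF assms] by simp
    then have pos: "D \<noteq> 0" "\<mu> + \<bar>D\<bar> > 0"
      by linarith+
    have b: "b > 0"
      unfolding b_def using pos by simp
    have fst: "fst ` C {b..} = {b..}" "fst ` C {..- b} = {..- b}"
      unfolding C_def b_def using outer_wavetrain_angles(2,4)[OF pos] by simp_all
    have "components (wavetrain_parameters \<alpha> \<beta> h \<mu>) = {C {b..}, C {..- b}}"
      unfolding wavetrain_parameters_eq D_def[symmetric] C_def b_def
      by (rule components_subcritical[OF D])
    moreover have "b \<in> {b..}" "b \<notin> {..- b}"
      using b by simp_all
    then have "C {b..} \<noteq> C {..- b}"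
      using fst by metis
    moreover have "\<not> bounded (fst ` C {b..})" "\<forall>k\<in>fst ` C {b..}. k > 0"
      "\<not> bounded (fst ` C {..- b})" "\<forall>k\<in>fst ` C {..- b}. k < 0"
      unfolding fst using b not_bounded_half_line by auto
    ultimately show ?thesis
      by blast
  qed
  show "\<exists>C\<^sub>1 C\<^sub>2. components (wavetrain_parameters \<alpha> \<beta> h \<mu>) = {C\<^sub>1, C\<^sub>2} \<and> C\<^sub>1 \<noteq> C\<^sub>2 \<and>
           graph_over_k_axis C\<^sub>1 \<and> graph_over_k_axis C\<^sub>2"
    if "subsubcritical \<alpha> \<beta> h \<mu>"
  proof -
    have "\<mu> < - \<bar>h - \<beta> / \<alpha>\<bar>"
      using that unfolding regime_iff[OF assms] .
    from components_subsubcritical[OF this] show ?thesis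
      unfolding wavetrain_parameters_eq by blast
  qed

  fix F G b
  show "hopf_threshold \<alpha> \<beta> h \<mu> b"
    if "transition (subcritical \<alpha> \<beta> h) (supercritical \<alpha> \<beta> h) \<mu> F G \<and> b \<in> {e3, - e3} \<and>
        (loses_stability \<alpha> \<beta> h b \<mu> F G \<or> gains_stability \<alpha> \<beta> h b \<mu> F G)" "\<beta> \<noteq> 0"
    using that pole[of b] exchange_of_stability_at_pole[OF assms]
      hopf_threshold_at_marginal_anisotropy[OF assms] by metis
  show "supercritical_bifurcation \<alpha> \<beta> h b \<mu> F G"
    if "transition (subcritical \<alpha> \<beta> h) (supercritical \<alpha> \<beta> h) \<mu> F G \<and> b \<in> {e3, - e3} \<and>
        (loses_stability \<alpha> \<beta> h b \<mu> F G \<or> gains_stability \<alpha> \<beta> h b \<mu> F G)"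
    using that pole[of b] exchange_of_stability_at_pole[OF assms]
      supercritical_bifurcation_at_pole[OF assms] by metis
  show "hopf_threshold \<alpha> \<beta> h \<mu> b"
    if "transition (subcritical \<alpha> \<beta> h) (subsubcritical \<alpha> \<beta> h) \<mu> F G \<and> b \<in> {e3, - e3} \<and>
        (loses_stability \<alpha> \<beta> h b \<mu> F G \<or> gains_stability \<alpha> \<beta> h b \<mu> F G)" "\<beta> \<noteq> 0"
    using that pole[of b] exchange_of_stability_at_pole[OF assms]
      hopf_threshold_at_marginal_anisotropy[OF assms] by metis
  show "subcritical_bifurcation \<alpha> \<beta> h b \<mu> F G"
    if "transition (subcritical \<alpha> \<beta> h) (subsubcritical \<alpha> \<beta> h) \<mu> F G \<and> b \<in> {e3, - e3} \<and>
        (loses_stability \<alpha> \<beta> h b \<mu> F G \<or> gains_stability \<alpha> \<beta> h b \<mu> F G)"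
    using that pole[of b] exchange_of_stability_at_pole[OF assms]
      subcritical_bifurcation_at_pole[OF assms] by metis

  assume ne: "h \<noteq> \<beta> / \<alpha>"
  \<comment> \<open>The pole \<open>\<epsilon> e\<^sub>3\<close> bifurcates at \<open>\<bar>D\<bar>\<close> and the opposite one at \<open>- \<bar>D\<bar>\<close>.\<close>
  define \<epsilon> where "\<epsilon> = sgn (h - \<beta> / \<alpha>)"
  have \<epsilon>: "\<epsilon>\<^sup>2 = 1" "(- \<epsilon>)\<^sup>2 = 1" "\<bar>h - \<beta> / \<alpha>\<bar> = \<epsilon> * (h - \<beta> / \<alpha>)"
    "- \<bar>h - \<beta> / \<alpha>\<bar> = - \<epsilon> * (h - \<beta> / \<alpha>)"
    using ne unfolding \<epsilon>_def by (auto simp: sgn_if)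
  have T: "transition (subcritical \<alpha> \<beta> h) (supercritical \<alpha> \<beta> h) \<bar>h - \<beta> / \<alpha>\<bar>
      (at_left \<bar>h - \<beta> / \<alpha>\<bar>) (at_right \<bar>h - \<beta> / \<alpha>\<bar>)"
    unfolding transition_sub_to_supercritical_iff[OF assms] using ne by blast
  show "\<exists>\<mu>\<^sub>c F G. \<exists>b\<in>{e3, - e3}.
           transition (subcritical \<alpha> \<beta> h) (supercritical \<alpha> \<beta> h) \<mu>\<^sub>c F G \<and>
           supercritical_bifurcation \<alpha> \<beta> h b \<mu>\<^sub>c F G"
    using T supercritical_bifurcation_at_pole[OF assms \<epsilon>(1,3) T] pole'[OF \<epsilon>(1)] by blast
  have T': "transition (subcritical \<alpha> \<beta> h) (subsubcritical \<alpha> \<beta> h) (- \<bar>h - \<beta> / \<alpha>\<bar>)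
      (at_right (- \<bar>h - \<beta> / \<alpha>\<bar>)) (at_left (- \<bar>h - \<beta> / \<alpha>\<bar>))"
    unfolding transition_sub_to_subsubcritical_iff[OF assms] using ne by blast
  show "\<exists>\<mu>\<^sub>c F G. \<exists>b\<in>{e3, - e3}.
           transition (subcritical \<alpha> \<beta> h) (subsubcritical \<alpha> \<beta> h) \<mu>\<^sub>c F G \<and>
           subcritical_bifurcation \<alpha> \<beta> h b \<mu>\<^sub>c F G"
    using T' subcritical_bifurcation_at_pole[OF assms \<epsilon>(2,4) T'] pole'[OF \<epsilon>(2)] by blast
qed

end
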